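(* Let $\Phi=\{\phi_i\}_{i\in\mathcal{D}}$ be a conformal iterated function system satisfying the open set condition, with attractor $X\subset\mathbb{R}^d$. Then there exists $Y\subset X$ with $\dim_{H}(Y)=\dim_{H}(X)$ such that, if $z\in Y$ and $\theta:\mathbb{N}\to\mathbb{R}_{\geq 0}$ satisfies $$\sum_{n=1}^{\infty}\sum_{I\in\mathcal{D}^{n}}(Diam(X_I)\theta(n))^{\dim_{H}(X)}=\infty,$$ then $\mathcal{H}^{\dim_{H}(X)}$-almost every $x\in X$ is an element of $W(\theta,z)$.
   Context: An iterated function system (IFS) is a finite set of contractions $\Phi=\{\phi_i\}_{i\in\mathcal{D}}$ of a closed subset of $\mathbb{R}^d$ into itself; its attractor is the unique non-empty compact set $X$ with $X=\bigcup_{i\in\mathcal{D}}\phi_i(X)$. Write $\mathcal{D}^n$ for words of length $n$ over $\mathcal{D}$, $\mathcal{D}^*=\bigcup_{n\ge1}\mathcal{D}^n$; for $I=(i_1,\dots,i_n)$, $|I|=n$, $\phi_I=\phi_{i_1}\circ\cdots\circ\phi_{i_n}$, $X_I=\phi_I(X)$. $\dim_H$ and $\mathcal{H}^s$ denote Hausdorff dimension and $s$-dimensional Hausdorff measure, $Diam$ denotes diameter, $B(x,r)$ is the closed Euclidean ball of centre $x$ and radius $r$. Conformal IFS: an IFS $\Phi$ on a compact set $K\subset\mathbb{R}^d$ such that each $\phi_i$ extends to an injective conformal contraction on some open connected neighbourhood $V$ of $K$ (conformal: $C^1$ with $|\phi_i'(x)y|=|\phi_i'(x)||y|$ for all $x\in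 V$, $y\in\mathbb{R}^d$), with $0<\inf_{x\in V}|\phi_i'(x)|\le\sup_{x\in V}|\phi_i'(x)|<1$, and such that for some $\alpha,c>0$, $||\phi_i'(x)|-|\phi_i'(y)||\le c|x-y|^\alpha$ for all $x,y\in V$, $i\in\mathcal{D}$. Open set condition: there is a non-empty open set $O\subset\mathbb{R}^d$ (in the domain of the maps) with $\phi_i(O)\subset O$ for all $i\in\mathcal{D}$ and $\phi_i(O)\cap\phi_j(O)=\emptyset$ for all $i\ne j$. For $z\in X$ and $\theta:\mathbb{N}\to\mathbb{R}_{\ge0}$, $$W(\theta,z):=\{x\in X: x\in B(\phi_I(z),Diam(X_I)\theta(|I|))\text{ for infinitely many } I\in\mathcal{D}^*\}.$$ *)

theory Defs
  imports "HOL-Analysis.Analysis"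
begin

(* Nonnegative real powers with the convention 0 to the power 0 is 1, whereas 0 powr 0 = 0.
   The convention is what makes the 0-dimensional Hausdorff measure the counting measure. *)
definition rpow :: "real \<Rightarrow> real \<Rightarrow> real" where
  "rpow x s = (if s = 0 then 1 else x powr s)"

(* The covering sets are required to be bounded because "diameter" is a real number and carries
   no information for unbounded sets. Empty covering sets contribute 0 also when s = 0, so that
   finite covers are included. *)
definition hausdorff_premeasure :: "real \<Rightarrow> real \<Rightarrow> 'a::metric_space set \<Rightarrow> ennreal" where
  "hausdorff_premeasure s \<delta> A =
     (INF U \<in> {U :: nat \<Rightarrow> 'a set. A \<subseteq> (\<Union>k. U k) \<and> (\<forall>k. bounded (U k) \<and> diameter (U k) \<le> \<delta>)}.
        \<Sum>k. if U k = {} then 0 else ennreal (rpow (diameter (U k)) s))"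

(* The Hausdorff (outer) measure, defined on all subsets. *)
definition hausdorff_measure :: "real \<Rightarrow> 'a::metric_space set \<Rightarrow> ennreal" where
  "hausdorff_measure s A = (SUP \<delta> \<in> {0<..}. hausdorff_premeasure s \<delta> A)"

(* Restricted to Euclidean spaces: there the set below is never empty (it contains every
   s > DIM('a)), so the infimum in the reals is the true one. *)
definition hausdorff_dim :: "'a::euclidean_space set \<Rightarrow> real" where
  "hausdorff_dim A = Inf {s. 0 \<le> s \<and> hausdorff_measure s A = 0}"

definition contraction_on :: "'a::metric_space set \<Rightarrow> ('a \<Rightarrow> 'a) \<Rightarrow> bool" where
  "contraction_on S f \<longleftrightarrow> (\<exists>r<1. r-lipschitz_on S f)"

definition ifs :: "'a::euclidean_space set \<Rightarrow> 'i set \<Rightarrow> ('i \<Rightarrow> 'a \<Rightarrow> 'a) \<Rightarrow> bool" where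
  "ifs K D \<phi> \<longleftrightarrow> finite D \<and> closed K \<and> (\<forall>i\<in>D. \<phi> i ` K \<subseteq> K \<and> contraction_on K (\<phi> i))"

definition attractor ::
  "'a::euclidean_space set \<Rightarrow> 'i set \<Rightarrow> ('i \<Rightarrow> 'a \<Rightarrow> 'a) \<Rightarrow> 'a set \<Rightarrow> bool" where
  "attractor K D \<phi> X \<longleftrightarrow> X \<subseteq> K \<and> X \<noteq> {} \<and> compact X \<and> X = (\<Union>i\<in>D. \<phi> i ` X)"

(* f is C1 and conformal on V with derivative f'; the norm on 'a \<Rightarrow>\<^sub>L 'a is the operator norm. *)
definition conformal_on ::
  "'a::euclidean_space set \<Rightarrow> ('a \<Rightarrow> 'a) \<Rightarrow> ('a \<Rightarrow> 'a \<Rightarrow>\<^sub>L 'a) \<Rightarrow> bool" where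
  "conformal_on V f f' \<longleftrightarrow>
     (\<forall>x\<in>V. (f has_derivative blinfun_apply (f' x)) (at x)) \<and>
     continuous_on V f' \<and>
     (\<forall>x\<in>V. \<forall>y. norm (blinfun_apply (f' x) y) = norm (f' x) * norm y)"

(* The functions \<phi> i already denote the extensions to V of the maps of the IFS on K; their values
   outside V are irrelevant. Infima and suprema are taken in the extended reals, where they
   always exist. *)
definition conformal_ifs ::
  "'a::euclidean_space set \<Rightarrow> 'a set \<Rightarrow> 'i set \<Rightarrow> ('i \<Rightarrow> 'a \<Rightarrow> 'a) \<Rightarrow> bool" where
  "conformal_ifs K V D \<phi> \<longleftrightarrow>
     ifs K D \<phi> \<and> compact K \<and> open V \<and> connected V \<and> K \<subseteq> V \<and>
     (\<exists>\<phi>'. (\<forall>i\<in>D. inj_on (\<phi> i) V \<and> contraction_on V (\<phi> i) \<and> conformal_on V (\<phi> i) (\<phi>' i) \<and>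
                 0 < (INF x\<in>V. ereal (norm (\<phi>' i x))) \<and>
                 (SUP x\<in>V. ereal (norm (\<phi>' i x))) < 1) \<and>
           (\<exists>\<alpha>>0. \<exists>c>0. \<forall>i\<in>D. \<forall>x\<in>V. \<forall>y\<in>V.
              \<bar>norm (\<phi>' i x) - norm (\<phi>' i y)\<bar> \<le> c * norm (x - y) powr \<alpha>))"

definition open_set_condition ::
  "'a::euclidean_space set \<Rightarrow> 'i set \<Rightarrow> ('i \<Rightarrow> 'a \<Rightarrow> 'a) \<Rightarrow> bool" where
  "open_set_condition V D \<phi> \<longleftrightarrow>
     (\<exists>U. open U \<and> U \<noteq> {} \<and> U \<subseteq> V \<and> (\<forall>i\<in>D. \<phi> i ` U \<subseteq> U) \<and>
          (\<forall>i\<in>D. \<forall>j\<in>D. i \<noteq> j \<longrightarrow> \<phi> i ` U \<inter> \<phi> j ` U = {}))"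

definition words :: "'i set \<Rightarrow> nat \<Rightarrow> 'i list set" where
  "words D n = {I. set I \<subseteq> D \<and> length I = n}"

primrec word_map :: "('i \<Rightarrow> 'a \<Rightarrow> 'a) \<Rightarrow> 'i list \<Rightarrow> 'a \<Rightarrow> 'a" where
  "word_map \<phi> [] = id"
| "word_map \<phi> (i # I) = \<phi> i \<circ> word_map \<phi> I"

definition limsup_set ::
  "'i set \<Rightarrow> ('i \<Rightarrow> 'a \<Rightarrow> 'a) \<Rightarrow> 'a::euclidean_space set \<Rightarrow> (nat \<Rightarrow> real) \<Rightarrow> 'a \<Rightarrow> 'a set" where
  "limsup_set D \<phi> X \<theta> z =
     {x \<in> X. infinite {I \<in> (\<Union>n\<in>{1..}. words D n).
        x \<in> cball (word_map \<phi> I z) (diameter (word_map \<phi> I ` X) * \<theta> (length I))}}"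

end

theory Submission
  imports Defs "HOL-Complex_Analysis.Great_Picard" "HOL-Library.Sublist"
begin

text \<open>
The set \<open>Y\<close> can be taken to be \<open>X\<close> itself.

Fix a point of \<open>X\<close> and let \<open>lam I\<close> be the norm of the derivative of \<open>word_map \<phi> I\<close> there. Bounded
distortion makes \<open>lam\<close> multiplicative up to a constant factor, and cylinders
\<open>word_map \<phi> I ` X\<close> have diameter comparable to \<open>lam I\<close>. For such a weight there is a critical
exponent \<open>s > 0\<close> at which the sums of \<open>lam I powr s\<close> over the words of length \<open>n\<close> stay between two
positive constants (\<open>pressure_zero\<close>), and a limit of such sums over the extensions of a word
defines an additive weight \<open>\<nu>\<close> comparable to \<open>lam I powr s\<close> (\<open>gibbs_weight_exists\<close>). This is the
restriction of a Gibbs measure to cylinders. The open set condition bounds the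
number of incomparable cylinders of size about \<open>\<delta>\<close> that meet a ball of radius \<open>\<delta>\<close>
(\<open>antichain_card_bound\<close>). So every cover of \<open>X\<close> by balls satisfies \<open>\<Sum> \<delta>\<^sup>s \<ge> c0 > 0\<close>, and \<open>s\<close> is the
Hausdorff dimension of \<open>X\<close> (\<open>hausdorff_dim_attractor\<close>).

Now let \<open>z \<in> X\<close>. Since the sum of \<open>diameter (word_map \<phi> I ` X) powr s\<close> over the words of length \<open>n\<close>
is bounded, the hypothesis forces \<open>\<Sum> \<theta>(n)\<^sup>s = \<infinity>\<close>. Choose a word \<open>t n\<close> whose cylinder contains \<open>z\<close> and
has size about \<open>\<theta>(n)\<close>. Then the ball around \<open>word_map \<phi> I z\<close>, for \<open>I\<close> of length \<open>n\<close>, contains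
the cylinder of \<open>I @ t n\<close>. Hence a point of \<open>X\<close> lies in the limsup set as soon as a coding sequence
of it shows the word \<open>t n\<close> at position \<open>n\<close> for infinitely many \<open>n\<close>. As \<open>\<nu> (t n)\<close> is comparable to
\<open>\<theta>(n)\<^sup>s\<close> when \<open>\<theta>(n)\<close> is small, this is a shrinking target problem with a divergent sum of target
weights.

The events "\<open>t n\<close> at position \<open>n\<close>" are quasi-independent on average, whatever the words \<open>t n\<close> are.
If \<open>n < n'\<close> and the occurrences do not overlap, the weight of the joint event is at most a constant
times \<open>\<nu> (t n) * \<nu> (t n')\<close>. If they overlap, forget all but the first \<open>n' - n\<close> letters of \<open>t n\<close>:
these have weight at most a constant times \<open>\<rho> ^ (n' - n)\<close>, with \<open>\<rho> < 1\<close>, so that the joint event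
has weight at most a constant times \<open>\<rho> ^ (n' - n) * \<nu> (t n')\<close>, and these bounds add up to a
constant times \<open>\<nu> (t n')\<close>. The second moment method then shows that, inside every cylinder, a fixed
proportion of the words is hit within finitely many steps (\<open>hits_have_positive_proportion\<close>).
Repeating this in the cylinders that are left, the words without a hit have arbitrarily small total
weight (\<open>shrinking_targets\<close>). The points outside the limsup set form a countable union, over \<open>N\<close>,
of sets of points whose codings have no hit from position \<open>N\<close> on. The cylinders of the remaining words
cover such a set, so it is null for the \<open>s\<close>-dimensional Hausdorff measure.

If \<open>D\<close> has a single element, \<open>X\<close> is a point, and the limsup set is all of \<open>X\<close>.
\<close>

section \<open>Words\<close>

lemma words_0 [simp]: "words D 0 = {[]}"
  by (auto simp: words_def)

lemma finite_words [simp]: "finite D \<Longrightarrow> finite (words D n)"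
  using finite_lists_length_eq[of D n] by (simp add: words_def)

lemma words_1: "words D (Suc 0) = (\<lambda>i. [i]) ` D"
  by (auto simp: words_def length_Suc_conv)

lemma wordsD: "I \<in> words D n \<Longrightarrow> set I \<subseteq> D" "I \<in> words D n \<Longrightarrow> length I = n"
  by (auto simp: words_def)

lemma append_in_words: "J \<in> words D a \<Longrightarrow> J' \<in> words D b \<Longrightarrow> J @ J' \<in> words D (a + b)"
  by (auto simp: words_def)

lemma words_add: "words D (a + b) = (\<lambda>(J, J'). J @ J') ` (words D a \<times> words D b)"
proof
  show "words D (a + b) \<subseteq> (\<lambda>(J, J'). J @ J') ` (words D a \<times> words D b)"
  proof
    fix W assume W: "W \<in> words D (a + b)"
    have "W = take a W @ drop a W" by simp
    moreover have "take a W \<in> words D a" "drop a W \<in> words D b"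
      using W by (auto simp: words_def dest: in_set_takeD in_set_dropD)
    ultimately show "W \<in> (\<lambda>(J, J'). J @ J') ` (words D a \<times> words D b)"
      by (intro image_eqI[of _ _ "(take a W, drop a W)"]) auto
  qed
qed (auto simp: words_def)

text \<open>Splitting words at a fixed position turns sums over words into iterated sums. All independence
arguments below rest on this.\<close>
lemma sum_words_add:
  "(\<Sum>W\<in>words D (a + b). f W) = (\<Sum>J\<in>words D a. \<Sum>J'\<in>words D b. f (J @ J'))"
proof -
  have "inj_on (\<lambda>(J, J'). J @ J') (words D a \<times> words D b)"
    by (auto simp: inj_on_def words_def)
  then show ?thesis
    by (simp add: words_add sum.reindex sum.cartesian_product case_prod_unfold)
qed

lemma card_words_pos: "finite D \<Longrightarrow> D \<noteq> {} \<Longrightarrow> 0 < card (words D n)"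
  by (simp add: words_def card_lists_length_eq card_gt_0_iff)

section \<open>Quasi-multiplicative weights on words\<close>

locale quasi_multiplicative =
  fixes D :: "'i set" and w :: "'i list \<Rightarrow> real" and C :: real
  assumes finite_D: "finite D" and D_nonempty: "D \<noteq> {}" and C_ge_1: "1 \<le> C"
    and w_pos: "set I \<subseteq> D \<Longrightarrow> 0 < w I"
    and w_append_le: "set I \<subseteq> D \<Longrightarrow> set J \<subseteq> D \<Longrightarrow> w (I @ J) \<le> C * w I * w J"
    and w_append_ge: "set I \<subseteq> D \<Longrightarrow> set J \<subseteq> D \<Longrightarrow> w I * w J \<le> C * w (I @ J)"
begin

definition Z :: "nat \<Rightarrow> real" where "Z n = (\<Sum>I\<in>words D n. w I)"

lemma Z_pos: "0 < Z n"
  unfolding Z_def using finite_D D_nonempty card_words_pos[OF finite_D D_nonempty, of n]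
  by (intro sum_pos) (auto simp: wordsD w_pos)

lemma C_pos: "0 < C"
  using C_ge_1 by linarith

lemma Z_add_le: "Z (a + b) \<le> C * Z a * Z b"
proof -
  have "Z (a + b) \<le> (\<Sum>J\<in>words D a. \<Sum>J'\<in>words D b. C * w J * w J')"
    unfolding Z_def sum_words_add by (intro sum_mono w_append_le) (auto simp: wordsD)
  also have "\<dots> = C * Z a * Z b"
    unfolding mult.assoc Z_def sum_product by (simp add: sum_distrib_left)
  finally show ?thesis .
qed

lemma Z_add_ge: "Z a * Z b \<le> C * Z (a + b)"
proof -
  have "Z a * Z b = (\<Sum>J\<in>words D a. \<Sum>J'\<in>words D b. w J * w J')"
    by (simp add: Z_def sum_product)
  also have "\<dots> \<le> (\<Sum>J\<in>words D a. \<Sum>J'\<in>words D b. C * w (J @ J'))"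
    by (intro sum_mono w_append_ge) (auto simp: wordsD)
  also have "\<dots> = C * Z (a + b)"
    by (simp add: Z_def sum_words_add sum_distrib_left)
  finally show ?thesis .
qed

lemma Z_mult_le: "C * Z (Suc k * n) \<le> (C * Z n) ^ Suc k"
proof (induction k)
  case (Suc k)
  have "C * Z (Suc (Suc k) * n) \<le> C * (C * Z n * Z (Suc k * n))"
    using Z_add_le[of n "Suc k * n"] C_pos by simp
  also have "\<dots> = (C * Z n) * (C * Z (Suc k * n))" by simp
  also have "\<dots> \<le> (C * Z n) * (C * Z n) ^ Suc k"
    using Suc C_pos Z_pos[of n] by (intro mult_left_mono) auto
  finally show ?case by simp
qed simp

lemma Z_mult_ge: "(Z n / C) ^ Suc k \<le> Z (Suc k * n) / C"
proof (induction k)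
  case (Suc k)
  have "(Z n / C) ^ Suc (Suc k) \<le> (Z n / C) * (Z (Suc k * n) / C)"
    unfolding power_Suc[of _ "Suc k"]
    using C_pos Z_pos[of n] by (intro mult_left_mono Suc) simp
  also have "\<dots> \<le> Z (Suc (Suc k) * n) / C"
    using Z_add_ge[of n "Suc k * n"] C_pos by (simp add: field_simps)
  finally show ?case .
qed simp

lemma Z_0: "Z 0 \<le> C" "1 \<le> C * Z 0"
proof -
  have p: "0 < w []" by (simp add: w_pos)
  have "w [] * w [] \<le> C * w []" "w [] \<le> C * w [] * w []"
    using w_append_ge[of "[]" "[]"] w_append_le[of "[]" "[]"] by auto
  then show "Z 0 \<le> C" "1 \<le> C * Z 0" using p by (auto simp: Z_def)
qed

text \<open>The two cases "\<open>C * Z n < 1\<close> for some \<open>n\<close>" and "\<open>C < Z m\<close> for some \<open>m\<close>" mean exponential decay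
and exponential growth along multiples, so they exclude each other. This replaces the existence of
the pressure as a limit.\<close>
lemma Z_dichotomy:
  assumes "C * Z n < 1" shows "Z m \<le> C"
proof (rule ccontr)
  assume *: "\<not> Z m \<le> C"
  then obtain m' where m: "m = Suc m'" using Z_0(1) by (cases m) auto
  obtain n' where n: "n = Suc n'" using Z_0(2) assms by (cases n) auto
  \<comment> \<open>Compare decay and growth at the common multiple \<open>m * n\<close>.\<close>
  have "C * Z (m * n) < 1"
    using Z_mult_le[of m' n] assms C_pos Z_pos[of n] power_le_one[of "C * Z n" m']
    unfolding m by (smt (verit) m mult_pos_pos power_Suc_less_one)
  moreover have "1 \<le> Z (n * m) / C"
    using * C_pos unfolding n by (intro order.trans[OF one_le_power Z_mult_ge]) simp
  ultimately show False using C_ge_1 C_pos Z_pos[of "m * n"]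
    by (smt (verit) divide_le_eq_1_pos le_divide_eq_1_pos mult.commute mult_le_cancel_right1)
qed

lemma quasi_multiplicative_powr:
  "0 \<le> t \<Longrightarrow> quasi_multiplicative D (\<lambda>I. w I powr t) (C powr t)"
proof
  assume t: "0 \<le> t"
  show "finite D" "D \<noteq> {}" using finite_D D_nonempty by auto
  show "1 \<le> C powr t" using C_ge_1 t by (rule ge_one_powr_ge_zero)
  fix I assume I: "set I \<subseteq> D"
  then show "0 < w I powr t" using w_pos[of I] by simp
  fix J assume J: "set J \<subseteq> D"
  show "w (I @ J) powr t \<le> C powr t * w I powr t * w J powr t"
    using powr_mono2[OF t _ w_append_le[OF I J]] I J C_pos
    by (simp add: powr_mult less_imp_le w_pos)
  show "w I powr t * w J powr t \<le> C powr t * w (I @ J) powr t"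
    using powr_mono2[OF t _ w_append_ge[OF I J]] I J C_pos
    by (simp add: powr_mult less_imp_le w_pos)
qed

subsection \<open>The critical exponent\<close>

text \<open>Let \<open>s\<close> be the infimum of the exponents \<open>t\<close> for which the sums of \<open>w I powr t\<close> decay. If they
decayed at \<open>s\<close>, then by continuity also slightly below \<open>s\<close>; if they grew at \<open>s\<close>, then also slightly
above, where some exponents give decay. So neither happens at \<open>s\<close>, which bounds the sums on both
sides for all \<open>n\<close> simultaneously. With at least two letters the sums grow at exponent \<open>0\<close>, so
\<open>s\<close> is positive.\<close>
lemma pressure_zero:
  assumes card: "2 \<le> card D" and r: "0 < r" "r < 1"
    and decay: "\<And>I. set I \<subseteq> D \<Longrightarrow> w I \<le> r ^ length I"
  obtains s where "0 < s"
    "\<And>n. 1 \<le> C powr s * (\<Sum>I\<in>words D n. w I powr s)"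
    "\<And>n. (\<Sum>I\<in>words D n. w I powr s) \<le> C powr s"
proof -
  define Zt where "Zt t n = (\<Sum>I\<in>words D n. w I powr t)" for t n
  have Zt_cont: "continuous_on UNIV (\<lambda>t. Zt t n)" for n
    unfolding Zt_def by (intro continuous_intros) (auto dest!: w_pos[OF wordsD(1)])
  have cont: "continuous_on UNIV (\<lambda>t. C powr t * Zt t n)" for n
    using C_pos by (intro continuous_intros Zt_cont) auto
  define T where "T = {t. 0 \<le> t \<and> (\<exists>n. C powr t * Zt t n < 1)}"
  define s where "s = Inf T"
  have dich: "Zt t m \<le> C powr t" if "t \<in> T" for t m
  proof -
    obtain n where n: "0 \<le> t" "C powr t * Zt t n < 1" using \<open>t \<in> T\<close> unfolding T_def by blast
    interpret t: quasi_multiplicative D "\<lambda>I. w I powr t" "C powr t"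
      by (rule quasi_multiplicative_powr[OF n(1)])
    show ?thesis using t.Z_dichotomy[of n m] n by (simp add: t.Z_def Zt_def)
  qed
  have "T \<noteq> {}"
  proof -
    obtain n where n: "r ^ n < 1 / (2 * C)"
      using real_arch_pow_inv[of "1 / (2 * C)" r] r C_pos by auto
    \<comment> \<open>Each of the \<open>k\<close> summands is at most \<open>1 / 2 ^ k\<close> at exponent \<open>k\<close>, and \<open>k < 2 ^ k\<close>.\<close>
    define k where "k = card (words D n)"
    have "C powr real k * Zt (real k) n = (\<Sum>I\<in>words D n. (C * w I) powr real k)"
      using C_pos by (simp add: Zt_def sum_distrib_left powr_mult less_imp_le wordsD w_pos)
    also have "\<dots> \<le> (\<Sum>I\<in>words D n. (1 / 2) powr real k)"
    proof (intro sum_mono powr_mono2)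
      fix I assume I: "I \<in> words D n"
      have "w I \<le> 1 / (2 * C)" using decay[of I] n I by (auto simp: wordsD)
      then have "C * w I \<le> C * (1 / (2 * C))" using C_pos by (intro mult_left_mono) auto
      then show "C * w I \<le> 1 / 2" using C_pos by simp
      show "0 \<le> C * w I" using w_pos[of I] I C_pos by (simp add: wordsD less_imp_le)
    qed auto
    also have "\<dots> = real k / 2 ^ k"
      by (simp add: k_def powr_realpow power_one_over field_simps)
    also have "\<dots> < 1" using of_nat_less_two_power[of k, where 'a=real] by simp
    finally show ?thesis unfolding T_def by (auto intro!: exI[of _ "real k"] exI[of _ n])
  qed
  moreover have bdd: "bdd_below T" by (auto simp: T_def intro!: bdd_belowI[of _ 0])
  ultimately have s0: "0 \<le> s" unfolding s_def by (intro cInf_greatest) (auto simp: T_def)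
  have lower: "1 \<le> C powr s * Zt s n" for n
  proof (rule ccontr)
    assume less: "\<not> 1 \<le> C powr s * Zt s n"
    have "s \<noteq> 0"
    proof
      assume s: "s = 0"
      have "Zt 0 n = (\<Sum>I\<in>words D n. 1)"
        unfolding Zt_def by (intro sum.cong refl) (auto dest!: w_pos[OF wordsD(1)])
      then show False using less s card_words_pos[OF finite_D D_nonempty, of n] C_pos by simp
    qed
    have "((\<lambda>t. C powr t * Zt t n) \<longlongrightarrow> C powr s * Zt s n) (at s)"
      using cont[of n] by (simp add: continuous_on_def)
    then have "eventually (\<lambda>t. C powr t * Zt t n < 1) (at s)"
      using less by (intro order_tendstoD) auto
    then obtain d where d: "0 < d" "\<And>t. t \<noteq> s \<Longrightarrow> dist t s < d \<Longrightarrow> C powr t * Zt t n < 1"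
      unfolding eventually_at by auto
    define t where "t = max 0 (s - d / 2)"
    have "t < s" "0 \<le> t" "dist t s < d"
      using d(1) s0 \<open>s \<noteq> 0\<close> by (auto simp: t_def dist_real_def max_def)
    then have "t \<in> T" using d(2)[of t] by (auto simp: T_def)
    then show False using \<open>t < s\<close> cInf_lower[OF _ bdd, of t] by (auto simp: s_def)
  qed
  have upper: "Zt s m \<le> C powr s" for m
  proof (rule ccontr)
    assume less: "\<not> Zt s m \<le> C powr s"
    have "((\<lambda>t. Zt t m - C powr t) \<longlongrightarrow> Zt s m - C powr s) (at s)"
      using Zt_cont[of m] C_pos by (intro tendsto_intros) (auto simp: continuous_on_def)
    then have "eventually (\<lambda>t. 0 < Zt t m - C powr t) (at s)"
      using less by (intro order_tendstoD) auto
    then obtain d where d: "0 < d" "\<And>t. t \<noteq> s \<Longrightarrow> dist t s < d \<Longrightarrow> C powr t < Zt t m"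
      unfolding eventually_at by auto
    obtain t where t: "t \<in> T" "t < s + d"
      using cInf_lessD[OF \<open>T \<noteq> {}\<close>, of "s + d"] d(1) by (auto simp: s_def)
    have "s \<le> t" using t(1) bdd by (simp add: s_def cInf_lower)
    then have "C powr t < Zt t m" using d(2)[of t] t less by (cases "t = s") (auto simp: dist_real_def)
    then show False using dich[OF t(1), of m] by simp
  qed
  have "s \<noteq> 0"
  proof
    assume "s = 0"
    then have "Zt 0 (Suc 0) \<le> 1" using upper[of "Suc 0"] C_pos by simp
    moreover have "Zt 0 (Suc 0) = (\<Sum>I\<in>words D (Suc 0). 1)"
      unfolding Zt_def by (intro sum.cong refl) (auto dest!: w_pos[OF wordsD(1)])
    moreover have "card (words D (Suc 0)) = card D"
      by (simp add: words_1 card_image inj_on_def)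
    ultimately show False using card by simp
  qed
  then show ?thesis using that[of s] s0 lower upper by (auto simp: Zt_def)
qed

end


context quasi_multiplicative
begin

subsection \<open>Gibbs weights\<close>

text \<open>For fixed \<open>L\<close>, giving a word \<open>I\<close> the total weight of its extensions of length \<open>L\<close> is additive on the
words shorter than \<open>L\<close>, and comparable to \<open>w I\<close> uniformly in \<open>L\<close>. There are countably many words, so
a diagonal subsequence of these weights converges at each of them.\<close>
lemma gibbs_weight_exists:
  assumes A: "1 \<le> A" "\<And>n. Z n \<le> A" "\<And>n. 1 \<le> A * Z n"
  obtains \<nu> where
    "\<And>I. set I \<subseteq> D \<Longrightarrow> \<nu> I = (\<Sum>i\<in>D. \<nu> (I @ [i]))"
    "\<And>I. set I \<subseteq> D \<Longrightarrow> w I \<le> A * C * \<nu> I"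
    "\<And>I. set I \<subseteq> D \<Longrightarrow> \<nu> I \<le> A * C * w I"
proof -
  define f where "f L I = (if length I \<le> L then \<Sum>J\<in>words D (L - length I). w (I @ J) else 0)"
    for L I
  have f_le: "f L I \<le> A * C * w I" if I: "set I \<subseteq> D" for L I
  proof (cases "length I \<le> L")
    case True
    have "f L I \<le> (\<Sum>J\<in>words D (L - length I). C * w I * w J)"
      using True I by (auto simp: f_def words_def intro!: sum_mono w_append_le)
    also have "\<dots> = C * w I * Z (L - length I)" by (simp add: Z_def sum_distrib_left)
    also have "\<dots> \<le> C * w I * A"
      using A(2) C_pos w_pos[OF I] by (intro mult_left_mono) auto
    finally show ?thesis by (simp add: mult_ac)
  qed (use A(1) C_pos w_pos[OF I] in \<open>simp add: f_def\<close>)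
  have f_ge: "w I \<le> A * C * f L I" if I: "set I \<subseteq> D" and L: "length I \<le> L" for L I
  proof -
    have "w I * Z (L - length I) = (\<Sum>J\<in>words D (L - length I). w I * w J)"
      by (simp add: Z_def sum_distrib_left)
    also have "\<dots> \<le> (\<Sum>J\<in>words D (L - length I). C * w (I @ J))"
      using I by (auto simp: words_def intro!: sum_mono w_append_ge)
    also have "\<dots> = C * f L I" using L by (simp add: f_def sum_distrib_left)
    finally have "A * (w I * Z (L - length I)) \<le> A * (C * f L I)"
      using A(1) by (intro mult_left_mono) auto
    moreover have "w I * 1 \<le> w I * (A * Z (L - length I))"
      using A(3) w_pos[OF I] by (intro mult_left_mono) auto
    ultimately show ?thesis by (simp add: mult_ac)
  qed
  have f_nonneg: "0 \<le> f L I" if "set I \<subseteq> D" for L I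
    using that by (auto simp: f_def words_def intro!: sum_nonneg less_imp_le[OF w_pos])
  have f_add: "f L I = (\<Sum>i\<in>D. f L (I @ [i]))" if L: "length I < L" for L I
  proof -
    have "L - length I = Suc 0 + (L - length (I @ [undefined]))" using L by simp
    then have "f L I = (\<Sum>J\<in>words D (Suc 0). \<Sum>J'\<in>words D (L - Suc (length I)). w (I @ J @ J'))"
      using L by (simp only: f_def sum_words_add) simp
    also have "\<dots> = (\<Sum>i\<in>D. \<Sum>J'\<in>words D (L - Suc (length I)). w (I @ [i] @ J'))"
      by (simp add: words_1 sum.reindex inj_on_def)
    also have "\<dots> = (\<Sum>i\<in>D. f L (I @ [i]))" using L by (simp add: f_def)
    finally show ?thesis .
  qed
  have bound: "norm (f L I) \<le> A * C * A" if "I \<in> lists D" for L I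
  proof -
    have I: "set I \<subseteq> D" using that by auto
    have "I \<in> words D (length I)" using I by (simp add: words_def)
    then have "w I \<le> Z (length I)"
      unfolding Z_def using finite_D
      by (intro member_le_sum) (auto dest!: wordsD(1) intro!: less_imp_le[OF w_pos])
    then have "w I \<le> A" using A(2)[of "length I"] by linarith
    then have "A * C * w I \<le> A * C * A" using A(1) C_pos by (intro mult_left_mono) auto
    then show ?thesis using f_le[OF I, of L] f_nonneg[OF I, of L] by simp
  qed
  have "countable (lists D)" using finite_D by (intro countable_lists countable_finite)
  from function_convergent_subsequence[of "lists D" f, OF this bound]
  obtain k where k: "strict_mono k" "\<And>I. I \<in> lists D \<Longrightarrow> \<exists>l. (\<lambda>n. f (k n) I) \<longlonglongrightarrow> l"
    by metis
  define \<nu> where "\<nu> I = lim (\<lambda>n. f (k n) I)" for I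
  have lim: "(\<lambda>n. f (k n) I) \<longlonglongrightarrow> \<nu> I" if "set I \<subseteq> D" for I
    using k(2)[of I] that unfolding \<nu>_def by (auto simp: in_lists_conv_set dest: limI)
  have large: "\<forall>\<^sub>F n in sequentially. l \<le> k n" for l
    using eventually_ge_at_top[of l]
    by eventually_elim (use seq_suble[OF k(1)] order.trans in blast)
  show ?thesis
  proof (rule that)
    fix I assume I: "set I \<subseteq> D"
    have "(\<lambda>n. \<Sum>i\<in>D. f (k n) (I @ [i])) \<longlonglongrightarrow> (\<Sum>i\<in>D. \<nu> (I @ [i]))"
      using I by (intro tendsto_sum lim) auto
    moreover have "\<forall>\<^sub>F n in sequentially. (\<Sum>i\<in>D. f (k n) (I @ [i])) = f (k n) I"
      using large[of "Suc (length I)"] by eventually_elim (simp add: f_add)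
    ultimately have "(\<lambda>n. f (k n) I) \<longlonglongrightarrow> (\<Sum>i\<in>D. \<nu> (I @ [i]))"
      using tendsto_cong by fast
    then show "\<nu> I = (\<Sum>i\<in>D. \<nu> (I @ [i]))" using lim[OF I] LIMSEQ_unique by blast
    show "w I \<le> A * C * \<nu> I"
    proof (rule tendsto_lowerbound[OF tendsto_mult[OF tendsto_const lim[OF I]]])
      show "\<forall>\<^sub>F n in sequentially. w I \<le> A * C * f (k n) I"
        using large[of "length I"] by eventually_elim (rule f_ge[OF I])
    qed simp
    show "\<nu> I \<le> A * C * w I"
      by (rule tendsto_upperbound[OF lim[OF I]]) (auto intro!: always_eventually f_le I)
  qed
qed

end

section \<open>Shrinking targets for Gibbs weights\<close>

definition occurs_at :: "'i list \<Rightarrow> nat \<Rightarrow> 'i list \<Rightarrow> bool" where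
  "occurs_at t q W \<longleftrightarrow> take (length t) (drop q W) = t"

locale gibbs_weight = quasi_multiplicative D \<nu> C for D :: "'i set" and \<nu> C +
  fixes \<rho> :: real
  assumes additive: "set I \<subseteq> D \<Longrightarrow> \<nu> I = (\<Sum>i\<in>D. \<nu> (I @ [i]))"
    and \<rho>: "0 < \<rho>" "\<rho> < 1"
    and decay: "set I \<subseteq> D \<Longrightarrow> \<nu> I \<le> C * \<rho> ^ length I"
begin

lemma sum_extensions: "set I \<subseteq> D \<Longrightarrow> (\<Sum>J\<in>words D n. \<nu> (I @ J)) = \<nu> I"
proof (induction n)
  case (Suc n)
  have "(\<Sum>J\<in>words D (n + Suc 0). \<nu> (I @ J)) = (\<Sum>J\<in>words D n. \<Sum>i\<in>D. \<nu> ((I @ J) @ [i]))"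
    by (simp only: sum_words_add) (simp add: words_1 sum.reindex inj_on_def)
  also have "\<dots> = (\<Sum>J\<in>words D n. \<nu> (I @ J))"
    using Suc.prems by (intro sum.cong refl additive[symmetric]) (auto dest: wordsD)
  finally show ?case using Suc by simp
qed simp

lemma sum_hit:
  assumes t: "set t \<subseteq> D" and L: "q + length t \<le> L" and I: "set I \<subseteq> D"
  shows "(\<Sum>W\<in>words D L. if occurs_at t q W then \<nu> (I @ W) else 0) = (\<Sum>J\<in>words D q. \<nu> (I @ J @ t))"
proof -
  define b where "b = L - q - length t"
  have "L = q + (length t + b)" using L by (simp add: b_def)
  then have "(\<Sum>W\<in>words D L. if occurs_at t q W then \<nu> (I @ W) else 0) =
    (\<Sum>J\<in>words D q. \<Sum>T\<in>words D (length t). \<Sum>R\<in>words D b.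
       if occurs_at t q (J @ T @ R) then \<nu> (I @ J @ T @ R) else 0)"
    by (simp add: sum_words_add)
  also have "\<dots> = (\<Sum>J\<in>words D q. \<Sum>T\<in>words D (length t). if T = t then \<nu> (I @ J @ t) else 0)"
  proof (intro sum.cong refl)
    fix J T assume JT: "J \<in> words D q" "T \<in> words D (length t)"
    have "occurs_at t q (J @ T @ R) \<longleftrightarrow> T = t" for R using JT by (simp add: occurs_at_def words_def)
    then show "(\<Sum>R\<in>words D b. if occurs_at t q (J @ T @ R) then \<nu> (I @ J @ T @ R) else 0) =
        (if T = t then \<nu> (I @ J @ t) else 0)"
      using sum_extensions[of "I @ J @ t" b] I JT t by (auto simp: words_def)
  qed
  also have "\<dots> = (\<Sum>J\<in>words D q. \<nu> (I @ J @ t))"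
    using t finite_D by (simp add: sum.delta words_def finite_words[unfolded words_def])
  finally show ?thesis .
qed

lemma hit_probability_ge:
  assumes t: "set t \<subseteq> D" and L: "q + length t \<le> L" and I: "set I \<subseteq> D"
  shows "\<nu> I * \<nu> t \<le> C * (\<Sum>W\<in>words D L. if occurs_at t q W then \<nu> (I @ W) else 0)"
proof -
  have "\<nu> I * \<nu> t = (\<Sum>J\<in>words D q. \<nu> (I @ J) * \<nu> t)"
    using sum_extensions[OF I, of q] by (simp add: sum_distrib_right[symmetric])
  also have "\<dots> \<le> (\<Sum>J\<in>words D q. C * \<nu> ((I @ J) @ t))"
    using I t by (intro sum_mono w_append_ge) (auto dest: wordsD)
  finally show ?thesis by (simp add: sum_hit[OF assms] sum_distrib_left)
qed

lemma hit_probability_le: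
  assumes t: "set t \<subseteq> D" and L: "q + length t \<le> L" and I: "set I \<subseteq> D"
  shows "(\<Sum>W\<in>words D L. if occurs_at t q W then \<nu> (I @ W) else 0) \<le> C * \<nu> I * \<nu> t"
proof -
  have "(\<Sum>J\<in>words D q. \<nu> ((I @ J) @ t)) \<le> (\<Sum>J\<in>words D q. C * \<nu> (I @ J) * \<nu> t)"
    using I t by (intro sum_mono w_append_le) (auto dest: wordsD)
  also have "\<dots> = C * \<nu> I * \<nu> t"
    using sum_extensions[OF I, of q] by (simp add: sum_distrib_right[symmetric] sum_distrib_left[symmetric])
  finally show ?thesis by (simp add: sum_hit[OF assms])
qed

text \<open>Two occurrences that do not overlap: the letters before, between and after them are summed out by
additivity, at the price of one factor \<open>C\<close> for each occurrence.\<close>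
lemma hit_pair_probability_le:
  assumes u: "set u \<subseteq> D" and t: "set t \<subseteq> D"
    and q: "q + length u \<le> q'" and L: "q' + length t \<le> L" and I: "set I \<subseteq> D"
  shows "(\<Sum>W\<in>words D L. if occurs_at u q W \<and> occurs_at t q' W then \<nu> (I @ W) else 0)
           \<le> C\<^sup>2 * \<nu> I * \<nu> u * \<nu> t"
proof -
  define b where "b = q' - q - length u"
  have q': "q' = q + (length u + b)" using q by (simp add: b_def)
  define n where "n = q' + length t"
  have n: "n = q + (length u + (b + length t))" by (simp add: n_def q')
  obtain e where e: "L = n + e" using L le_iff_add[of n L] by (auto simp: n_def)
  let ?P = "\<lambda>W. occurs_at u q W \<and> occurs_at t q' W"
  have "(\<Sum>W\<in>words D L. if ?P W then \<nu> (I @ W) else 0) =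
      (\<Sum>W\<in>words D n. \<Sum>R\<in>words D e. if ?P W then \<nu> ((I @ W) @ R) else 0)"
    unfolding e sum_words_add
  proof (intro sum.cong refl)
    fix W R assume "W \<in> words D n"
    then have "?P (W @ R) = ?P W" by (simp add: occurs_at_def words_def n_def q')
    then show "(if ?P (W @ R) then \<nu> (I @ W @ R) else 0) = (if ?P W then \<nu> ((I @ W) @ R) else 0)"
      by simp
  qed
  also have "\<dots> = (\<Sum>W\<in>words D n. if ?P W then \<nu> (I @ W) else 0)"
  proof (intro sum.cong refl)
    fix W assume "W \<in> words D n"
    then show "(\<Sum>R\<in>words D e. if ?P W then \<nu> ((I @ W) @ R) else 0) = (if ?P W then \<nu> (I @ W) else 0)"
      using sum_extensions[of "I @ W" e] I by (auto simp: words_def)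
  qed
  also have "\<dots> = (\<Sum>J\<in>words D q. \<Sum>U\<in>words D (length u). \<Sum>J'\<in>words D b. \<Sum>T\<in>words D (length t).
      if T = t \<and> U = u then \<nu> (I @ J @ u @ J' @ t) else 0)"
    unfolding n sum_words_add
  proof (intro sum.cong refl)
    fix J U J' T
    assume *: "J \<in> words D q" "U \<in> words D (length u)" "J' \<in> words D b" "T \<in> words D (length t)"
    have "?P (J @ U @ J' @ T) \<longleftrightarrow> T = t \<and> U = u"
      using * by (auto simp: occurs_at_def words_def q')
    then show "(if ?P (J @ U @ J' @ T) then \<nu> (I @ J @ U @ J' @ T) else 0) =
      (if T = t \<and> U = u then \<nu> (I @ J @ u @ J' @ t) else 0)" by auto
  qed
  also have "\<dots> = (\<Sum>J\<in>words D q. \<Sum>U\<in>words D (length u). if U = u then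
      \<Sum>J'\<in>words D b. \<Sum>T\<in>words D (length t). if T = t then \<nu> (I @ J @ u @ J' @ t) else 0 else 0)"
    by (intro sum.cong refl) auto
  also have "\<dots> = (\<Sum>J\<in>words D q. \<Sum>J'\<in>words D b. \<nu> (I @ J @ u @ J' @ t))"
  proof -
    have "u \<in> words D (length u)" "t \<in> words D (length t)" using u t by (auto simp: words_def)
    then show ?thesis using finite_D by (simp add: sum.delta)
  qed
  also have "\<dots> \<le> (\<Sum>J\<in>words D q. \<Sum>J'\<in>words D b. C * \<nu> ((I @ J @ u) @ J') * \<nu> t)"
  proof (intro sum_mono)
    fix J J' assume "J \<in> words D q" "J' \<in> words D b"
    then show "\<nu> (I @ J @ u @ J' @ t) \<le> C * \<nu> ((I @ J @ u) @ J') * \<nu> t"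
      using w_append_le[of "(I @ J @ u) @ J'" t] I t u by (simp add: wordsD)
  qed
  also have "\<dots> = C * \<nu> t * (\<Sum>J\<in>words D q. \<nu> (I @ J @ u))"
  proof -
    have "(\<Sum>J'\<in>words D b. C * \<nu> ((I @ J @ u) @ J') * \<nu> t) = C * \<nu> t * \<nu> (I @ J @ u)"
      if "J \<in> words D q" for J
      using sum_extensions[of "I @ J @ u" b] I u that
      by (simp add: sum_distrib_right[symmetric] sum_distrib_left[symmetric] wordsD)
    then show ?thesis by (simp add: sum_distrib_left)
  qed
  also have "\<dots> \<le> C * \<nu> t * (\<Sum>J\<in>words D q. C * \<nu> (I @ J) * \<nu> u)"
  proof (intro mult_left_mono sum_mono)
    fix J assume "J \<in> words D q"
    then show "\<nu> (I @ J @ u) \<le> C * \<nu> (I @ J) * \<nu> u"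
      using w_append_le[of "I @ J" u] I u by (simp add: wordsD)
  qed (use C_pos w_pos[OF t] in simp)
  also have "(\<Sum>J\<in>words D q. C * \<nu> (I @ J) * \<nu> u) = C * \<nu> I * \<nu> u"
    using sum_extensions[OF I, of q] by (simp add: sum_distrib_right[symmetric] sum_distrib_left[symmetric])
  finally show ?thesis by (simp add: power2_eq_square mult_ac)
qed

text \<open>The constant that Cauchy-Schwarz yields: \<open>C\<^sup>2\<close> for the square of the first moment, and
\<open>2 * C\<^sup>2 * (1 + C / (1 - \<rho>))\<close> for the second moment.\<close>
definition mixing_const :: real where
  "mixing_const = 2 * C ^ 4 * (1 + C / (1 - \<rho>))"

lemma mixing_const_ge_1: "1 \<le> mixing_const"
proof -
  have "1 \<le> C ^ 4" using C_ge_1 by simp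
  moreover have "1 \<le> 1 + C / (1 - \<rho>)" using \<rho> C_pos by simp
  ultimately have "1 * 1 \<le> C ^ 4 * (1 + C / (1 - \<rho>))" by (intro mult_mono) auto
  then show ?thesis by (simp add: mixing_const_def)
qed

text \<open>Second moment method inside the cylinder of \<open>I\<close>, with \<open>f\<close> counting the hits. For \<open>q < q'\<close> the
joint event has weight at most \<open>B q q'\<close>, by cutting \<open>t q\<close> down to its first \<open>q' - q\<close> letters and
so separating the two occurrences. For each \<open>q'\<close> the geometric terms add up to
at most \<open>C / (1 - \<rho>)\<close>, and \<open>1 \<le> S\<close> absorbs them in \<open>S\<^sup>2\<close>.\<close>
lemma hits_have_positive_proportion:
  assumes Q: "finite Q" and t: "\<And>q. q \<in> Q \<Longrightarrow> set (t q) \<subseteq> D"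
    and L: "\<And>q. q \<in> Q \<Longrightarrow> q + length (t q) \<le> L" and I: "set I \<subseteq> D"
    and S: "1 \<le> (\<Sum>q\<in>Q. \<nu> (t q))"
  shows "\<nu> I \<le> mixing_const * (\<Sum>W\<in>words D L. if \<exists>q\<in>Q. occurs_at (t q) q W then \<nu> (I @ W) else 0)"
proof -
  define S where "S = (\<Sum>q\<in>Q. \<nu> (t q))"
  define h where "h q W = (if occurs_at (t q) q W then 1 else 0 :: real)" for q W
  define f where "f W = (\<Sum>q\<in>Q. h q W)" for W
  define U where "U = (\<Sum>W\<in>words D L. if \<exists>q\<in>Q. occurs_at (t q) q W then \<nu> (I @ W) else 0)"
  define P where "P q q' = (\<Sum>W\<in>words D L. \<nu> (I @ W) * (h q W * h q' W))" for q q'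
  define B where "B q q' = (if q \<le> q' then C\<^sup>2 * \<nu> I * (\<nu> (t q) + C * \<rho> ^ (q' - q)) * \<nu> (t q') else 0)"
    for q q'
  have \<nu>I: "0 < \<nu> I" using w_pos[OF I] .
  have \<nu>t: "0 < \<nu> (t q)" if "q \<in> Q" for q using w_pos[OF t[OF that]] .
  have \<nu>W: "0 < \<nu> (I @ W)" if "W \<in> words D L" for W using that I by (intro w_pos) (auto dest: wordsD)
  have B_nonneg: "0 \<le> B q q'" if "q \<in> Q" "q' \<in> Q" for q q'
    using \<nu>I \<nu>t[OF that(1)] \<nu>t[OF that(2)] C_pos \<rho> by (simp add: B_def)
  have first: "\<nu> I * S \<le> C * (\<Sum>W\<in>words D L. \<nu> (I @ W) * f W)"
  proof -
    have "\<nu> I * S = (\<Sum>q\<in>Q. \<nu> I * \<nu> (t q))" by (simp add: S_def sum_distrib_left)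
    also have "\<dots> \<le> (\<Sum>q\<in>Q. C * (\<Sum>W\<in>words D L. if occurs_at (t q) q W then \<nu> (I @ W) else 0))"
      by (intro sum_mono hit_probability_ge t L I)
    also have "\<dots> = C * (\<Sum>q\<in>Q. \<Sum>W\<in>words D L. \<nu> (I @ W) * h q W)"
      unfolding sum_distrib_left by (intro sum.cong refl) (simp add: h_def)
    also have "\<dots> = C * (\<Sum>W\<in>words D L. \<nu> (I @ W) * f W)"
      unfolding f_def sum_distrib_left by (subst sum.swap) simp
    finally show ?thesis .
  qed
  have P_le_aux: "P q q' \<le> B q q'" if q: "q \<in> Q" "q' \<in> Q" "q \<le> q'" for q q'
  proof (cases "q = q'")
    case True
    have "P q q' = (\<Sum>W\<in>words D L. if occurs_at (t q) q W then \<nu> (I @ W) else 0)"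
      unfolding P_def True h_def by (intro sum.cong refl) simp
    also have "\<dots> \<le> C * \<nu> I * \<nu> (t q)" by (intro hit_probability_le t L I q)
    also have "\<dots> \<le> C\<^sup>2 * \<nu> I * (\<nu> (t q) + C) * \<nu> (t q)"
    proof -
      have "C * 1 \<le> C\<^sup>2 * (\<nu> (t q) + C)"
        using C_ge_1 \<nu>t[OF q(1)] by (intro mult_mono) (auto simp: power2_eq_square)
      then have "(C * 1) * (\<nu> I * \<nu> (t q)) \<le> (C\<^sup>2 * (\<nu> (t q) + C)) * (\<nu> I * \<nu> (t q))"
        using \<nu>I \<nu>t[OF q(1)] by (intro mult_right_mono) auto
      then show ?thesis by (simp add: mult_ac)
    qed
    finally show ?thesis using True by (simp add: B_def)
  next
    case False
    \<comment> \<open>If \<open>t q\<close> fits before \<open>q'\<close> then \<open>u = t q\<close>; otherwise \<open>u\<close> has length \<open>q' - q\<close> and small weight.\<close>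
    define u where "u = take (q' - q) (t q)"
    have u: "set u \<subseteq> D" using t[OF q(1)] by (auto simp: u_def dest: in_set_takeD)
    have "P q q' \<le> (\<Sum>W\<in>words D L. if occurs_at u q W \<and> occurs_at (t q') q' W then \<nu> (I @ W) else 0)"
      unfolding P_def
    proof (intro sum_mono)
      fix W assume W: "W \<in> words D L"
      have "occurs_at u q W" if "occurs_at (t q) q W"
      proof -
        have "take (length u) (drop q W) = take (length u) (take (length (t q)) (drop q W))"
          by (simp add: u_def min_def)
        also have "\<dots> = u" using that by (simp add: occurs_at_def u_def min_def)
        finally show ?thesis by (simp add: occurs_at_def)
      qed
      then show "\<nu> (I @ W) * (h q W * h q' W)
          \<le> (if occurs_at u q W \<and> occurs_at (t q') q' W then \<nu> (I @ W) else 0)"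
        using \<nu>W[OF W] by (auto simp: h_def)
    qed
    also have "\<dots> \<le> C\<^sup>2 * \<nu> I * \<nu> u * \<nu> (t q')"
      by (intro hit_pair_probability_le u t q L I) (use q(3) in \<open>simp add: u_def\<close>)
    also have "\<dots> \<le> C\<^sup>2 * \<nu> I * (\<nu> (t q) + C * \<rho> ^ (q' - q)) * \<nu> (t q')"
    proof -
      have "\<nu> u \<le> \<nu> (t q) + C * \<rho> ^ (q' - q)"
      proof (cases "length (t q) \<le> q' - q")
        case True
        then show ?thesis using C_pos \<rho> by (simp add: u_def)
      next
        case False
        then show ?thesis using decay[OF u] \<nu>t[OF q(1)] by (simp add: u_def)
      qed
      then show ?thesis using \<nu>I \<nu>t[OF q(2)] by (intro mult_right_mono mult_left_mono) auto
    qed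
    finally show ?thesis using q(3) by (simp add: B_def)
  qed
  have P_le: "P q q' \<le> B q q' + B q' q" if q: "q \<in> Q" "q' \<in> Q" for q q'
  proof (cases "q \<le> q'")
    case True
    then show ?thesis using P_le_aux[OF q] B_nonneg[OF q(2) q(1)] by simp
  next
    case False
    have "P q q' = P q' q" by (simp add: P_def mult_ac)
    then show ?thesis using False P_le_aux[OF q(2) q(1)] B_nonneg[OF q] by simp
  qed
  have B_sum: "(\<Sum>q\<in>Q. B q q') \<le> C\<^sup>2 * \<nu> I * (S + C / (1 - \<rho>)) * \<nu> (t q')" if q': "q' \<in> Q" for q'
  proof -
    let ?R = "\<lambda>q. if q \<le> q' then \<rho> ^ (q' - q) else 0"
    have "(\<Sum>q\<in>Q. ?R q) = (\<Sum>q\<in>Q \<inter> {..q'}. \<rho> ^ (q' - q))"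
      using Q by (simp add: sum.If_cases Int_def atMost_def)
    also have "\<dots> \<le> (\<Sum>q\<in>{..q'}. \<rho> ^ (q' - q))" using \<rho> by (intro sum_mono2) auto
    also have "\<dots> = (\<Sum>q\<in>{..q'}. \<rho> ^ q)"
      by (rule sum.reindex_bij_witness[of _ "\<lambda>q. q' - q" "\<lambda>q. q' - q"]) auto
    also have "\<dots> \<le> (\<Sum>q. \<rho> ^ q)" using \<rho> by (intro sum_le_suminf summable_geometric) auto
    also have "\<dots> = 1 / (1 - \<rho>)" using \<rho> by (simp add: suminf_geometric)
    finally have R: "(\<Sum>q\<in>Q. ?R q) \<le> 1 / (1 - \<rho>)" .
    have "(\<Sum>q\<in>Q. B q q') \<le> (\<Sum>q\<in>Q. C\<^sup>2 * \<nu> I * (\<nu> (t q) + C * ?R q) * \<nu> (t q'))"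
      using \<nu>I \<nu>t q' C_pos by (intro sum_mono) (auto simp: B_def intro!: mult_nonneg_nonneg less_imp_le)
    also have "\<dots> = C\<^sup>2 * \<nu> I * (S + C * (\<Sum>q\<in>Q. ?R q)) * \<nu> (t q')"
      by (simp add: sum_distrib_right[symmetric] sum_distrib_left[symmetric] sum.distrib S_def)
    also have "\<dots> \<le> C\<^sup>2 * \<nu> I * (S + C * (1 / (1 - \<rho>))) * \<nu> (t q')"
      using R \<nu>I \<nu>t[OF q'] C_pos by (intro mult_right_mono mult_left_mono add_left_mono) auto
    finally show ?thesis by simp
  qed
  have S1: "1 \<le> S" using S by (simp add: S_def)
  have "(\<Sum>W\<in>words D L. \<nu> (I @ W) * (f W)\<^sup>2) = (\<Sum>q\<in>Q. \<Sum>q'\<in>Q. P q q')"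
  proof -
    have "(\<Sum>W\<in>words D L. \<nu> (I @ W) * (f W)\<^sup>2) =
        (\<Sum>W\<in>words D L. \<Sum>q\<in>Q. \<Sum>q'\<in>Q. \<nu> (I @ W) * (h q W * h q' W))"
      by (simp only: f_def power2_eq_square sum_product) (simp only: sum_distrib_left)
    also have "\<dots> = (\<Sum>q\<in>Q. \<Sum>W\<in>words D L. \<Sum>q'\<in>Q. \<nu> (I @ W) * (h q W * h q' W))"
      by (rule sum.swap)
    also have "\<dots> = (\<Sum>q\<in>Q. \<Sum>q'\<in>Q. P q q')"
      unfolding P_def by (intro sum.cong refl) (rule sum.swap)
    finally show ?thesis .
  qed
  also have "\<dots> \<le> (\<Sum>q\<in>Q. \<Sum>q'\<in>Q. B q q' + B q' q)" by (intro sum_mono P_le)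
  also have "\<dots> = (\<Sum>q\<in>Q. \<Sum>q'\<in>Q. B q q') + (\<Sum>q\<in>Q. \<Sum>q'\<in>Q. B q' q)"
    by (simp add: sum.distrib)
  also have "(\<Sum>q\<in>Q. \<Sum>q'\<in>Q. B q q') = (\<Sum>q\<in>Q. \<Sum>q'\<in>Q. B q' q)" by (rule sum.swap)
  also have "(\<Sum>q\<in>Q. \<Sum>q'\<in>Q. B q' q) + (\<Sum>q\<in>Q. \<Sum>q'\<in>Q. B q' q)
      \<le> 2 * (\<Sum>q\<in>Q. C\<^sup>2 * \<nu> I * (S + C / (1 - \<rho>)) * \<nu> (t q))"
    using sum_mono[of Q "\<lambda>q. \<Sum>q'\<in>Q. B q' q", OF B_sum] by simp
  also have "\<dots> = 2 * C\<^sup>2 * \<nu> I * (S + C / (1 - \<rho>)) * S"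
    unfolding sum_distrib_left[symmetric] S_def[symmetric] by simp
  also have "\<dots> \<le> 2 * C\<^sup>2 * \<nu> I * (S * (1 + C / (1 - \<rho>))) * S"
  proof -
    have "C / (1 - \<rho>) * 1 \<le> C / (1 - \<rho>) * S" using S1 \<rho> C_pos by (intro mult_left_mono) auto
    then have "S + C / (1 - \<rho>) \<le> S * (1 + C / (1 - \<rho>))" by (simp add: algebra_simps)
    then show ?thesis using S1 \<nu>I by (intro mult_right_mono mult_left_mono) auto
  qed
  finally have second: "(\<Sum>W\<in>words D L. \<nu> (I @ W) * (f W)\<^sup>2)
      \<le> 2 * C\<^sup>2 * (1 + C / (1 - \<rho>)) * \<nu> I * S\<^sup>2"
    by (simp add: power2_eq_square mult_ac)
  have f0: "f W = 0" if "\<not> (\<exists>q\<in>Q. occurs_at (t q) q W)" for W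
    using that by (auto simp: f_def h_def intro!: sum.neutral)
  have U_nonneg: "0 \<le> U" unfolding U_def using \<nu>W by (intro sum_nonneg) (auto intro: less_imp_le)
  \<comment> \<open>Cauchy-Schwarz for the indicator of the support of \<open>f\<close> against \<open>f\<close>, weighted by \<open>\<nu>\<close>.\<close>
  let ?g = "\<lambda>W. if \<exists>q\<in>Q. occurs_at (t q) q W then sqrt (\<nu> (I @ W)) else 0"
  have "(\<Sum>W\<in>words D L. \<nu> (I @ W) * f W) = (\<Sum>W\<in>words D L. ?g W * (sqrt (\<nu> (I @ W)) * f W))"
    using \<nu>W f0 by (intro sum.cong refl) (auto simp: mult.assoc[symmetric] less_imp_le)
  then have "(\<Sum>W\<in>words D L. \<nu> (I @ W) * f W)\<^sup>2
      \<le> (\<Sum>W\<in>words D L. (?g W)\<^sup>2) * (\<Sum>W\<in>words D L. (sqrt (\<nu> (I @ W)) * f W)\<^sup>2)"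
    using Cauchy_Schwarz_ineq_sum[of ?g "\<lambda>W. sqrt (\<nu> (I @ W)) * f W" "words D L"] by simp
  also have "(\<Sum>W\<in>words D L. (?g W)\<^sup>2) = U"
    unfolding U_def using \<nu>W by (intro sum.cong refl) (auto simp: less_imp_le)
  also have "(\<Sum>W\<in>words D L. (sqrt (\<nu> (I @ W)) * f W)\<^sup>2) = (\<Sum>W\<in>words D L. \<nu> (I @ W) * (f W)\<^sup>2)"
    using \<nu>W by (intro sum.cong refl) (auto simp: less_imp_le power_mult_distrib)
  also have "U * \<dots> \<le> U * (2 * C\<^sup>2 * (1 + C / (1 - \<rho>)) * \<nu> I * S\<^sup>2)"
    using second U_nonneg by (rule mult_left_mono)
  finally have CS: "(\<Sum>W\<in>words D L. \<nu> (I @ W) * f W)\<^sup>2 \<le> U * (2 * C\<^sup>2 * (1 + C / (1 - \<rho>)) * \<nu> I * S\<^sup>2)" .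
  have "(\<nu> I * S)\<^sup>2 \<le> (C * (\<Sum>W\<in>words D L. \<nu> (I @ W) * f W))\<^sup>2"
    using first \<nu>I S1 by (intro power_mono) auto
  also have "\<dots> \<le> C\<^sup>2 * (U * (2 * C\<^sup>2 * (1 + C / (1 - \<rho>)) * \<nu> I * S\<^sup>2))"
    using CS by (simp add: power_mult_distrib mult_left_mono)
  also have "\<dots> = (mixing_const * U) * (\<nu> I * S\<^sup>2)"
    by (simp add: mixing_const_def power4_eq_xxxx power2_eq_square mult_ac)
  finally have "\<nu> I * (\<nu> I * S\<^sup>2) \<le> (mixing_const * U) * (\<nu> I * S\<^sup>2)"
    by (simp add: power2_eq_square mult_ac)
  then show ?thesis using \<nu>I S1 unfolding U_def[symmetric]
    by (subst (asm) mult_le_cancel_right_pos) auto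
qed

text \<open>\<open>B\<close> collects the words without a hit so far. In the cylinder of each of them, the tail of the
divergent series supplies finitely many further targets of total weight at least \<open>1\<close>, and these
remove the proportion \<open>1 / mixing_const\<close>. As \<open>B\<close> consists of words of one length \<open>L\<close>, the same
targets serve all of them.\<close>
lemma shrinking_targets_step:
  assumes t: "\<And>n. n \<in> S \<Longrightarrow> set (t n) \<subseteq> D"
    and diverge: "\<not> summable (\<lambda>n. if n \<in> S then \<nu> (t n) else 0)"
  shows "\<exists>L B. j \<le> L \<and> B \<subseteq> words D L \<and> sum \<nu> B \<le> (1 - 1 / mixing_const) ^ j * \<nu> [] \<and>
    (\<forall>W\<in>words D L - B. \<exists>n\<in>S. N \<le> n \<and> n + length (t n) \<le> L \<and> occurs_at (t n) n W)"
proof (induction j)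
  case 0
  show ?case by (intro exI[of _ 0] exI[of _ "{[]}"]) auto
next
  case (Suc j)
  then obtain L B where LB: "j \<le> L" "B \<subseteq> words D L" "sum \<nu> B \<le> (1 - 1 / mixing_const) ^ j * \<nu> []"
    "\<And>W. W \<in> words D L - B \<Longrightarrow> \<exists>n\<in>S. N \<le> n \<and> n + length (t n) \<le> L \<and> occurs_at (t n) n W"
    by blast
  define a where "a n = (if n \<in> S then \<nu> (t n) else 0)" for n
  have a_nonneg: "0 \<le> a n" for n using w_pos[OF t[of n]] by (auto simp: a_def less_imp_le)
  have "\<not> summable (\<lambda>n. a (n + (L + N)))"
    using diverge summable_iff_shift[of a "L + N"] by (simp add: a_def[abs_def])
  then obtain M where M: "1 \<le> (\<Sum>n<M. a (n + (L + N)))"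
    using summableI_nonneg_bounded[of "\<lambda>n. a (n + (L + N))" 1] a_nonneg by (meson linear)
  define Q where "Q = {q \<in> {N..<N + M}. L + q \<in> S}"
  define t' where "t' q = t (L + q)" for q
  have Q: "finite Q" by (simp add: Q_def)
  have t': "set (t' q) \<subseteq> D" if "q \<in> Q" for q using that t by (simp add: Q_def t'_def)
  have "(\<Sum>q\<in>Q. \<nu> (t' q)) = (\<Sum>q\<in>{N..<N + M}. a (q + L))"
    unfolding Q_def
    by (subst sum.inter_filter, simp, intro sum.cong refl) (auto simp: a_def t'_def add.commute)
  also have "\<dots> = (\<Sum>n<M. a (n + (L + N)))"
    by (rule sum.reindex_bij_witness[of _ "\<lambda>n. n + N" "\<lambda>q. q - N"]) (auto simp: add_ac)
  finally have S1: "1 \<le> (\<Sum>q\<in>Q. \<nu> (t' q))" using M by simp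
  \<comment> \<open>The sum bounds all end positions at once; the successor makes \<open>L\<close> grow with \<open>j\<close>.\<close>
  define l where "l = Suc (\<Sum>q\<in>Q. q + length (t' q))"
  have l: "q + length (t' q) \<le> l" if "q \<in> Q" for q
    using member_le_sum[of q Q "\<lambda>q. q + length (t' q)"] that Q by (simp add: l_def)
  define G where "G W' \<longleftrightarrow> (\<exists>q\<in>Q. occurs_at (t' q) q W')" for W'
  define B' where "B' = (\<lambda>(W, W'). W @ W') ` (B \<times> {W' \<in> words D l. \<not> G W'})"
  have B'_sub: "B' \<subseteq> words D (L + l)"
    using LB(2) by (auto simp: B'_def intro!: append_in_words)
  have inj: "inj_on (\<lambda>(W, W'). W @ W') (B \<times> {W' \<in> words D l. \<not> G W'})"
    using LB(2) by (auto simp: inj_on_def words_def subset_iff)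
  have miss: "(\<Sum>W'\<in>{W' \<in> words D l. \<not> G W'}. \<nu> (W @ W')) \<le> (1 - 1 / mixing_const) * \<nu> W"
    if W: "W \<in> B" for W
  proof -
    have setW: "set W \<subseteq> D" using W LB(2) by (auto simp: words_def)
    have "\<nu> W = (\<Sum>W'\<in>words D l. \<nu> (W @ W'))" using sum_extensions[OF setW] by simp
    also have "\<dots> = (\<Sum>W'\<in>words D l. (if \<not> G W' then \<nu> (W @ W') else 0) + (if G W' then \<nu> (W @ W') else 0))"
      by (intro sum.cong refl) simp
    also have "\<dots> = (\<Sum>W'\<in>{W' \<in> words D l. \<not> G W'}. \<nu> (W @ W'))
        + (\<Sum>W'\<in>words D l. if G W' then \<nu> (W @ W') else 0)"
      using finite_D by (simp add: sum.distrib sum.inter_filter)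
    finally have eq: "\<nu> W = \<dots>" .
    have "\<nu> W \<le> mixing_const * (\<Sum>W'\<in>words D l. if G W' then \<nu> (W @ W') else 0)"
      unfolding G_def by (rule hits_have_positive_proportion[OF Q t' l setW S1])
    then have "\<nu> W / mixing_const \<le> (\<Sum>W'\<in>words D l. if G W' then \<nu> (W @ W') else 0)"
      using mixing_const_ge_1 by (simp add: divide_le_eq mult.commute)
    moreover have "(1 - 1 / mixing_const) * \<nu> W = \<nu> W - \<nu> W / mixing_const"
      by (simp add: left_diff_distrib)
    ultimately show ?thesis using eq by linarith
  qed
  have "sum \<nu> B' = (\<Sum>W\<in>B. \<Sum>W'\<in>{W' \<in> words D l. \<not> G W'}. \<nu> (W @ W'))"
    unfolding B'_def by (subst sum.reindex[OF inj]) (simp add: sum.cartesian_product case_prod_unfold)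
  also have "\<dots> \<le> (\<Sum>W\<in>B. (1 - 1 / mixing_const) * \<nu> W)" by (intro sum_mono miss)
  also have "\<dots> = (1 - 1 / mixing_const) * sum \<nu> B" by (simp add: sum_distrib_left)
  also have "\<dots> \<le> (1 - 1 / mixing_const) * ((1 - 1 / mixing_const) ^ j * \<nu> [])"
    using mixing_const_ge_1 by (intro mult_left_mono LB(3)) simp
  finally have B'_sum: "sum \<nu> B' \<le> (1 - 1 / mixing_const) ^ Suc j * \<nu> []" by simp
  have cover: "\<exists>n\<in>S. N \<le> n \<and> n + length (t n) \<le> L + l \<and> occurs_at (t n) n V"
    if V: "V \<in> words D (L + l) - B'" for V
  proof -
    obtain W W' where W: "V = W @ W'" "W \<in> words D L" "W' \<in> words D l"
      using V by (auto simp: words_add)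
    have len: "length W = L" using W by (simp add: words_def)
    show ?thesis
    proof (cases "W \<in> B")
      case False
      then obtain n where n: "n \<in> S" "N \<le> n" "n + length (t n) \<le> L" "occurs_at (t n) n W"
        using LB(4)[of W] W by auto
      then have "occurs_at (t n) n V" using len by (simp add: occurs_at_def W(1))
      then show ?thesis using n by auto
    next
      case True
      have "G W'" using V True W by (auto simp: B'_def)
      then obtain q where q: "q \<in> Q" "occurs_at (t' q) q W'" by (auto simp: G_def)
      have "occurs_at (t (L + q)) (L + q) V" using q(2) len by (simp add: occurs_at_def W(1) t'_def)
      moreover have "L + q \<in> S" "N \<le> L + q" using q(1) by (auto simp: Q_def)
      moreover have "L + q + length (t (L + q)) \<le> L + l" using l[OF q(1)] by (simp add: t'_def)
      ultimately show ?thesis by blast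
    qed
  qed
  show ?case
    by (intro exI[of _ "L + l"] exI[of _ B'] conjI ballI cover B'_sum B'_sub)
      (use LB(1) in \<open>simp_all add: l_def\<close>)
qed

theorem shrinking_targets:
  assumes "\<And>n. n \<in> S \<Longrightarrow> set (t n) \<subseteq> D"
    and "\<not> summable (\<lambda>n. if n \<in> S then \<nu> (t n) else 0)" and "0 < e"
  obtains L B where "m \<le> L" "B \<subseteq> words D L" "sum \<nu> B < e"
    "\<And>W. W \<in> words D L - B \<Longrightarrow> \<exists>n\<in>S. N \<le> n \<and> n + length (t n) \<le> L \<and> occurs_at (t n) n W"
proof -
  have \<nu>0: "0 < \<nu> []" by (simp add: w_pos)
  let ?x = "1 - 1 / mixing_const"
  have x: "0 \<le> ?x" "?x < 1" using mixing_const_ge_1 by auto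
  obtain j where j: "?x ^ j < e / \<nu> []"
    using real_arch_pow_inv[of "e / \<nu> []" ?x] x \<nu>0 \<open>0 < e\<close> by auto
  have "?x ^ (j + m) \<le> ?x ^ j" using x by (intro power_decreasing) auto
  then have "?x ^ (j + m) < e / \<nu> []" using j by linarith
  then have less: "?x ^ (j + m) * \<nu> [] < e" using \<nu>0 by (simp add: pos_less_divide_eq)
  obtain L B where LB: "j + m \<le> L" "B \<subseteq> words D L" "sum \<nu> B \<le> ?x ^ (j + m) * \<nu> []"
    "\<forall>W\<in>words D L - B. \<exists>n\<in>S. N \<le> n \<and> n + length (t n) \<le> L \<and> occurs_at (t n) n W"
    using shrinking_targets_step[OF assms(1,2), of "j + m" N] by blast
  show ?thesis by (rule that[of L B]) (use LB less in auto)
qed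

end


section \<open>Images of balls and packing\<close>

text \<open>The image is open by invariance of domain, and the inverse has derivative of norm at most \<open>1 / l\<close>.
If the conclusion fails, let \<open>p\<close> be a point outside the image closest to \<open>f x\<close>, at distance
\<open>d < l * \<rho>\<close>. On the convex ball of radius \<open>d\<close>, which lies in the image, the inverse is
\<open>1 / l\<close>-Lipschitz, so this ball is contained in the compact image of the closed ball of radius
\<open>d / l < \<rho>\<close>. Its closure then lies in the image too, but contains \<open>p\<close>.\<close>
lemma ball_subset_image_ball:
  fixes f :: "'a::euclidean_space \<Rightarrow> 'a"
  assumes inj: "inj_on f (ball x \<rho>)"
    and deriv: "\<And>y. y \<in> ball x \<rho> \<Longrightarrow> (f has_derivative f' y) (at y)"
    and expand: "\<And>y h. y \<in> ball x \<rho> \<Longrightarrow> l * norm h \<le> norm (f' y h)"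
    and l: "0 < l" and \<rho>: "0 < \<rho>"
  shows "ball (f x) (l * \<rho>) \<subseteq> f ` ball x \<rho>"
proof (rule ccontr)
  let ?S = "ball x \<rho>"
  define G where "G = f ` ?S"
  define g where "g = inv_into ?S f"
  assume "\<not> ball (f x) (l * \<rho>) \<subseteq> f ` ?S"
  then obtain y where "y \<in> ball (f x) (l * \<rho>)" "y \<notin> G" unfolding G_def by blast
  then have y: "dist (f x) y < l * \<rho>" "y \<notin> G" by simp_all
  have cont: "continuous_on ?S f"
    using deriv has_derivative_continuous continuous_at_imp_continuous_on by blast
  then have "open G" unfolding G_def using inj by (intro invariance_of_domain) auto
  have gf: "g (f y) = y" if "y \<in> ?S" for y using inj that by (simp add: g_def)
  have g_deriv: "\<exists>g'. (g has_derivative g') (at q) \<and> onorm g' \<le> 1 / l" if q: "q \<in> G" for q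
  proof -
    obtain y where y: "y \<in> ?S" "q = f y" using q by (auto simp: G_def)
    have lin: "linear (f' y)" using deriv[OF y(1)] by (rule has_derivative_linear)
    have "inj (f' y)"
    proof (rule injI)
      fix a b assume "f' y a = f' y b"
      then have "f' y (a - b) = 0" using lin by (simp add: linear_diff)
      then show "a = b" using expand[OF y(1), of "a - b"] l by (simp add: mult_le_0_iff)
    qed
    then have "surj (f' y)" using lin linear_injective_imp_surjective by blast
    then obtain g' where g': "linear g'" "f' y \<circ> g' = id"
      using linear_surjective_right_inverse[OF lin] by blast
    have "(g has_derivative g') (at (f y))"
      using has_derivative_inverse_on[where S = ?S and f = f and f' = f' and g = g
          and g' = "\<lambda>_. g'" and x = y] deriv gf g' y(1) by auto
    moreover have "onorm g' \<le> 1 / l"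
    proof (rule onorm_bound)
      fix h
      have "l * norm (g' h) \<le> norm (f' y (g' h))" by (rule expand[OF y(1)])
      also have "f' y (g' h) = h" using g'(2) by (metis comp_apply id_apply)
      finally show "norm (g' h) \<le> 1 / l * norm h" using l by (simp add: field_simps)
    qed (use l in simp)
    ultimately show ?thesis using y(2) by blast
  qed
  then obtain g' where g': "\<And>q. q \<in> G \<Longrightarrow> (g has_derivative g' q) (at q)"
    "\<And>q. q \<in> G \<Longrightarrow> onorm (g' q) \<le> 1 / l"
    by metis
  have "closed (- G)" "- G \<noteq> {}" using \<open>open G\<close> y by auto
  then obtain p where p: "p \<in> - G" "infdist (f x) (- G) = dist (f x) p"
    using infdist_attains_inf by metis
  define d where "d = dist (f x) p"
  have "d \<le> dist (f x) y" unfolding d_def p(2)[symmetric] using y(2) by (intro infdist_le) auto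
  then have d_less: "d < l * \<rho>" using y(1) by simp
  have "f x \<in> G" using \<rho> by (simp add: G_def)
  then have "0 < d" using p(1) by (auto simp: d_def)
  have sub: "ball (f x) d \<subseteq> G"
  proof
    fix q assume "q \<in> ball (f x) d"
    then show "q \<in> G" using infdist_le[of q "- G" "f x"] p(2) by (force simp: d_def)
  qed
  have small: "cball x (d / l) \<subseteq> ?S"
    using d_less l by (auto simp: field_simps) (smt (verit) mult.commute mult_less_cancel_left_pos)
  have "ball (f x) d \<subseteq> f ` cball x (d / l)"
  proof
    fix q assume q: "q \<in> ball (f x) d"
    have "norm (g (f x) - g q) \<le> 1 / l * norm (f x - q)"
    proof (rule differentiable_bound[of "ball (f x) d" g g'])
      fix a assume "a \<in> ball (f x) d"
      then have "a \<in> G" using sub by blast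
      then show "(g has_derivative g' a) (at a within ball (f x) d)" "onorm (g' a) \<le> 1 / l"
        using g' has_derivative_at_withinI by blast+
    qed (use q \<open>0 < d\<close> in auto)
    also have "\<dots> \<le> 1 / l * d" using q l by (intro mult_left_mono) (auto simp: dist_norm)
    finally have "g q \<in> cball x (d / l)" using gf[of x] \<rho> by (simp add: dist_norm)
    moreover have "f (g q) = q"
      using q sub unfolding G_def g_def by (intro f_inv_into_f) blast
    ultimately show "q \<in> f ` cball x (d / l)" by (metis imageI)
  qed
  moreover have "closed (f ` cball x (d / l))"
    using cont small by (intro compact_imp_closed compact_continuous_image continuous_on_subset[OF cont]) auto
  ultimately have "closure (ball (f x) d) \<subseteq> f ` cball x (d / l)" by (rule closure_minimal)
  moreover have "p \<in> closure (ball (f x) d)" using \<open>0 < d\<close> by (simp add: d_def)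
  ultimately have "p \<in> G" using small by (auto simp: G_def)
  then show False using p(1) by simp
qed

text \<open>Compare volumes.\<close>
lemma card_disjoint_balls_le:
  fixes p :: "'i \<Rightarrow> 'a::euclidean_space"
  assumes F: "finite F" and disj: "disjoint_family_on (\<lambda>i. ball (p i) a) F"
    and sub: "\<And>i. i \<in> F \<Longrightarrow> ball (p i) a \<subseteq> ball c R" and a: "0 < a" and R: "0 < R"
  shows "real (card F) \<le> (R / a) ^ DIM('a)"
proof -
  have fin: "emeasure lborel (ball (p i) a) \<noteq> \<infinity>" for i
    using emeasure_lborel_ball_finite[of "p i" a] by (simp add: less_top)
  have "real (card F) * (unit_ball_vol DIM('a) * a ^ DIM('a)) = (\<Sum>i\<in>F. measure lborel (ball (p i) a))"
    using a by (simp add: content_ball)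
  also have "\<dots> = measure lborel (\<Union>i\<in>F. ball (p i) a)"
    using F disj by (intro measure_finite_Union[symmetric]) (use fin in auto)
  also have "\<dots> \<le> measure lborel (ball c R)"
    using sub
    by (intro measure_mono_fmeasurable fmeasurableI emeasure_lborel_ball_finite)
      (auto intro!: borel_open open_UN)
  also have "\<dots> = unit_ball_vol DIM('a) * R ^ DIM('a)" using R by (simp add: content_ball)
  finally have "unit_ball_vol DIM('a) * (real (card F) * a ^ DIM('a)) \<le> unit_ball_vol DIM('a) * R ^ DIM('a)"
    by (simp add: mult_ac)
  then have "real (card F) * a ^ DIM('a) \<le> R ^ DIM('a)"
    using unit_ball_vol_pos[of "DIM('a)"] by simp
  then show ?thesis using a by (simp add: power_divide pos_le_divide_eq)
qed

section \<open>Hausdorff measure\<close>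

text \<open>Countable subadditivity for null sets. The given finite covers of \<open>A N\<close>, with error
\<open>e / 2 ^ (N + 1)\<close>, are joined to a single sequence through \<open>prod_decode\<close> and padded with empty sets.\<close>
lemma hausdorff_measure_UN_eq_0:
  fixes A :: "nat \<Rightarrow> 'a::metric_space set"
  assumes s: "0 < s"
    and cover: "\<And>N \<delta> e. 0 < \<delta> \<Longrightarrow> 0 < e \<Longrightarrow> \<exists>F. finite F \<and> A N \<subseteq> \<Union>F \<and>
      (\<forall>U\<in>F. bounded U \<and> diameter U \<le> \<delta>) \<and> (\<Sum>U\<in>F. diameter U powr s) \<le> e"
  shows "hausdorff_measure s (\<Union>N. A N) = 0"
proof -
  have "hausdorff_premeasure s \<delta> (\<Union>N. A N) \<le> ennreal e" if \<delta>: "0 < \<delta>" and e: "0 < e" for \<delta> e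
  proof -
    have "\<exists>F. finite F \<and> A N \<subseteq> \<Union>F \<and> (\<forall>U\<in>F. bounded U \<and> diameter U \<le> \<delta>) \<and>
        (\<Sum>U\<in>F. diameter U powr s) \<le> e * (1 / 2) ^ Suc N" for N
      using cover[OF \<delta>, of "e * (1 / 2) ^ Suc N"] e by simp
    then obtain F where F: "\<And>N. finite (F N)" "\<And>N. A N \<subseteq> \<Union>(F N)"
      "\<And>N U. U \<in> F N \<Longrightarrow> bounded U \<and> diameter U \<le> \<delta>"
      "\<And>N. (\<Sum>U\<in>F N. diameter U powr s) \<le> e * (1 / 2) ^ Suc N"
      by metis
    have "\<exists>h. bij_betw h {0..<card (F N)} (F N)" for N
      using ex_bij_betw_nat_finite[OF F(1)] by blast
    then obtain h where h: "\<And>N. bij_betw (h N) {0..<card (F N)} (F N)" by metis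
    define V where "V = (\<lambda>(N, k). if k < card (F N) then h N k else {})"
    define U where "U = (\<lambda>n. V (prod_decode n))"
    define v where "v = (\<lambda>P. if V P = {} then 0 else ennreal (rpow (diameter (V P)) s))"
    have hF: "h N k \<in> F N" if "k < card (F N)" for N k
      using h[of N] that by (auto simp: bij_betw_def)
    have sub: "(\<Union>N. A N) \<subseteq> (\<Union>k. U k)"
    proof
      fix x assume "x \<in> (\<Union>N. A N)"
      then obtain N where "x \<in> \<Union>(F N)" using F(2) by blast
      then obtain B where B: "x \<in> B" "B \<in> F N" by blast
      then have "B \<in> h N ` {0..<card (F N)}" using h[of N] by (simp add: bij_betw_def)
      then obtain k where "k < card (F N)" "B = h N k" by auto
      then have "x \<in> U (prod_encode (N, k))" using B by (simp add: U_def V_def)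
      then show "x \<in> (\<Union>k. U k)" by blast
    qed
    have bd: "bounded (U k) \<and> diameter (U k) \<le> \<delta>" for k
      using \<delta> hF F(3) by (auto simp: U_def V_def split: prod.split)
    have row: "(\<Sum>k. v (N, k)) \<le> ennreal (e * (1 / 2) ^ Suc N)" for N
    proof -
      have "(\<Sum>k. v (N, k)) = (\<Sum>k<card (F N). v (N, k))"
        by (intro suminf_finite) (auto simp: v_def V_def)
      also have "\<dots> \<le> (\<Sum>k<card (F N). ennreal (diameter (h N k) powr s))"
        using s by (intro sum_mono) (auto simp: v_def V_def rpow_def)
      also have "\<dots> = ennreal (\<Sum>k<card (F N). diameter (h N k) powr s)" by simp
      also have "(\<Sum>k<card (F N). diameter (h N k) powr s) = (\<Sum>U\<in>F N. diameter U powr s)"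
        using sum.reindex_bij_betw[OF h, of "\<lambda>U. diameter U powr s" N] by (simp add: atLeast0LessThan)
      also have "ennreal \<dots> \<le> ennreal (e * (1 / 2) ^ Suc N)" by (intro ennreal_leI F(4))
      finally show ?thesis .
    qed
    have "hausdorff_premeasure s \<delta> (\<Union>N. A N)
        \<le> (\<Sum>k. if U k = {} then 0 else ennreal (rpow (diameter (U k)) s))"
      unfolding hausdorff_premeasure_def using sub bd by (intro INF_lower) auto
    also have "\<dots> = (\<Sum>i. v (prod_decode i))" unfolding U_def v_def ..
    also have "\<dots> = (\<Sum>N. \<Sum>k. v (N, k))" by (rule suminf_ennreal_2dimen) simp
    also have "\<dots> \<le> (\<Sum>N. ennreal (e * (1 / 2) ^ Suc N))" by (intro suminf_le row) auto
    also have "\<dots> = ennreal (e * 1)"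
      using e by (intro suminf_ennreal_eq sums_mult power_half_series) simp
    also have "\<dots> = ennreal e" by simp
    finally show ?thesis .
  qed
  then have "hausdorff_premeasure s \<delta> (\<Union>N. A N) = 0" if "0 < \<delta>" for \<delta>
    using ennreal_le_epsilon[of 0 "hausdorff_premeasure s \<delta> (\<Union>N. A N)"] that by simp
  then show ?thesis by (simp add: hausdorff_measure_def)
qed

lemma hausdorff_measure_mono: "A \<subseteq> B \<Longrightarrow> hausdorff_measure s A \<le> hausdorff_measure s B"
  unfolding hausdorff_measure_def hausdorff_premeasure_def
  by (intro SUP_mono' INF_superset_mono) auto

text \<open>To estimate the Hausdorff measure from below it suffices to treat finite covers by open balls:
a covering set \<open>U k\<close> is contained in a ball of slightly larger radius \<open>\<delta> k\<close> around one of its points,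
and \<open>\<delta> k\<close> is chosen such that its \<open>s\<close>-th power exceeds that of the diameter by a prescribed
summable amount.\<close>
lemma compact_cover_sum_lower_bound:
  fixes X :: "'a::metric_space set"
  assumes X: "compact X" and s: "0 < s" and c: "0 < c"
    and balls: "\<And>F p \<delta>. finite F \<Longrightarrow> (\<And>k::nat. k \<in> F \<Longrightarrow> 0 < \<delta> k) \<Longrightarrow>
      X \<subseteq> (\<Union>k\<in>F. ball (p k) (\<delta> k)) \<Longrightarrow> c \<le> (\<Sum>k\<in>F. \<delta> k powr s)"
    and U: "X \<subseteq> (\<Union>k. U k)" "\<And>k. bounded (U k)"
  shows "ennreal c \<le> (\<Sum>k. if U k = {} then 0 else ennreal (diameter (U k) powr s))"
proof (rule ccontr)
  define u where "u k = (if U k = {} then 0 else ennreal (diameter (U k) powr s))" for k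
  assume "\<not> ?thesis"
  then have less: "suminf u < ennreal c" by (simp add: u_def[abs_def] not_le)
  then obtain \<sigma> where \<sigma>: "0 \<le> \<sigma>" "suminf u = ennreal \<sigma>"
    by (cases "suminf u") auto
  define e where "e = c - \<sigma>"
  have e: "0 < e" using less \<sigma> by (simp add: e_def ennreal_less_iff)
  define \<delta> where "\<delta> k = (diameter (U k) powr s + e / 2 * (1 / 2) ^ Suc k) powr (1 / s)" for k
  define p where "p k = (SOME x. x \<in> U k)" for k
  have ek: "0 < e / 2 * (1 / 2) ^ Suc k" for k using e by simp
  have \<delta>s: "\<delta> k powr s = diameter (U k) powr s + e / 2 * (1 / 2) ^ Suc k" for k
    using s ek[of k] by (simp add: \<delta>_def powr_powr add_nonneg_pos less_imp_le del: power_Suc)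
  have \<delta>_pos: "0 < \<delta> k" for k
    using add_nonneg_pos[OF powr_ge_zero ek[of k], of "diameter (U k)" s]
    unfolding \<delta>_def powr_gt_zero by linarith
  have diam: "diameter (U k) < \<delta> k" for k
  proof (rule ccontr)
    assume "\<not> diameter (U k) < \<delta> k"
    then have "\<delta> k powr s \<le> diameter (U k) powr s"
      using \<delta>_pos[of k] s by (intro powr_mono2) auto
    then show False using \<delta>s[of k] ek[of k] by linarith
  qed
  have "X \<subseteq> (\<Union>k\<in>{k. U k \<noteq> {}}. ball (p k) (\<delta> k))"
  proof
    fix x assume "x \<in> X"
    then obtain k where k: "x \<in> U k" using U(1) by blast
    then have "p k \<in> U k" unfolding p_def by (metis someI)
    then have "dist (p k) x \<le> diameter (U k)" using k U(2) by (intro diameter_bounded_bound)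
    then show "x \<in> (\<Union>k\<in>{k. U k \<noteq> {}}. ball (p k) (\<delta> k))" using diam[of k] k by force
  qed
  then obtain F where F: "F \<subseteq> {k. U k \<noteq> {}}" "finite F" "X \<subseteq> (\<Union>k\<in>F. ball (p k) (\<delta> k))"
    using compactE_image[OF X, of "{k. U k \<noteq> {}}" "\<lambda>k. ball (p k) (\<delta> k)"] by auto
  have "c \<le> (\<Sum>k\<in>F. \<delta> k powr s)" using F \<delta>_pos by (intro balls)
  also have "\<dots> = (\<Sum>k\<in>F. diameter (U k) powr s) + e / 2 * (\<Sum>k\<in>F. (1 / 2) ^ Suc k)"
    unfolding \<delta>s by (simp add: sum.distrib sum_distrib_left)
  also have "\<dots> \<le> \<sigma> + e / 2 * 1"
  proof (intro add_mono mult_left_mono)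
    have "sum u F = (\<Sum>k\<in>F. ennreal (diameter (U k) powr s))"
      using F(1) by (intro sum.cong) (auto simp: u_def)
    then have "ennreal (\<Sum>k\<in>F. diameter (U k) powr s) = sum u F" by simp
    also have "\<dots> \<le> suminf u" using F(2) by (intro sum_le_suminf) auto
    finally show "(\<Sum>k\<in>F. diameter (U k) powr s) \<le> \<sigma>" using \<sigma> by simp
    have "(\<Sum>k\<in>F. (1 / 2::real) ^ Suc k) \<le> (\<Sum>k. (1 / 2) ^ Suc k)"
      using F(2) power_half_series by (intro sum_le_suminf) (auto dest: sums_summable)
    also have "\<dots> = 1" using power_half_series by (rule sums_unique[symmetric])
    finally show "(\<Sum>k\<in>F. (1 / 2::real) ^ Suc k) \<le> 1" .
  qed (use e in auto)
  finally show False using e by (simp add: e_def field_simps)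
qed


section \<open>Bounded distortion near the attractor\<close>

text \<open>The chain rule for conformal maps: if \<open>n i\<close> is the norm of the derivative of \<open>\<phi> i\<close>, this is the norm
of the derivative of \<open>word_map \<phi> I\<close>.\<close>
primrec word_scale :: "('i \<Rightarrow> 'a \<Rightarrow> real) \<Rightarrow> ('i \<Rightarrow> 'a \<Rightarrow> 'a) \<Rightarrow> 'i list \<Rightarrow> 'a \<Rightarrow> real" where
  "word_scale n \<phi> [] x = 1"
| "word_scale n \<phi> (i # I) x = n i (word_map \<phi> I x) * word_scale n \<phi> I x"

lemma word_map_append: "word_map \<phi> (I @ J) = word_map \<phi> I \<circ> word_map \<phi> J"
  by (induction I) (auto simp: o_assoc)

lemma word_scale_append:
  "word_scale n \<phi> (I @ J) x = word_scale n \<phi> I (word_map \<phi> J x) * word_scale n \<phi> J x"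
  by (induction I) (auto simp: word_map_append)

lemma word_map_invariant:
  assumes "\<And>i. i \<in> D \<Longrightarrow> \<phi> i ` S \<subseteq> S" "set I \<subseteq> D" "x \<in> S"
  shows "word_map \<phi> I x \<in> S"
  using assms(2) by (induction I) (use assms(1,3) in auto)

text \<open>A conformal system restricted to the \<open>\<epsilon>\<close>-neighbourhood \<open>W\<close> of \<open>K\<close>. The extensions may
map points of their domain \<open>V\<close> out of \<open>V\<close>, but they map \<open>W\<close> into itself, so that compositions are
conformal on \<open>W\<close>. The open set \<open>U\<close> is contained in \<open>W\<close>, and all constants are uniform in \<open>i\<close>.\<close>
locale conformal_system =
  fixes K W X U :: "'a::euclidean_space set" and D :: "'i set" and \<phi> :: "'i \<Rightarrow> 'a \<Rightarrow> 'a"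
    and \<phi>' :: "'i \<Rightarrow> 'a \<Rightarrow> 'a \<Rightarrow>\<^sub>L 'a" and \<epsilon> r m c \<alpha> :: real
  assumes finite_D: "finite D" and D_nonempty: "D \<noteq> {}"
    and compact_K: "compact K" and W_eq: "W = (\<Union>x\<in>K. ball x \<epsilon>)" and \<epsilon>: "0 < \<epsilon>"
    and K_maps: "i \<in> D \<Longrightarrow> \<phi> i ` K \<subseteq> K"
    and contract: "i \<in> D \<Longrightarrow> x \<in> W \<Longrightarrow> y \<in> W \<Longrightarrow> dist (\<phi> i x) (\<phi> i y) \<le> r * dist x y"
    and inj_W: "i \<in> D \<Longrightarrow> inj_on (\<phi> i) W"
    and deriv: "i \<in> D \<Longrightarrow> x \<in> W \<Longrightarrow> (\<phi> i has_derivative blinfun_apply (\<phi>' i x)) (at x)"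
    and conformal: "i \<in> D \<Longrightarrow> x \<in> W \<Longrightarrow> norm (blinfun_apply (\<phi>' i x) h) = norm (\<phi>' i x) * norm h"
    and norm_ge: "i \<in> D \<Longrightarrow> x \<in> W \<Longrightarrow> m \<le> norm (\<phi>' i x)"
    and norm_le: "i \<in> D \<Longrightarrow> x \<in> W \<Longrightarrow> norm (\<phi>' i x) \<le> r"
    and holder: "i \<in> D \<Longrightarrow> x \<in> W \<Longrightarrow> y \<in> W \<Longrightarrow>
      \<bar>norm (\<phi>' i x) - norm (\<phi>' i y)\<bar> \<le> c * dist x y powr \<alpha>"
    and m: "0 < m" and r: "0 < r" "r < 1" and c: "0 < c" and \<alpha>: "0 < \<alpha>"
    and X_K: "X \<subseteq> K" and X_nonempty: "X \<noteq> {}" and compact_X: "compact X"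
    and X_eq: "X = (\<Union>i\<in>D. \<phi> i ` X)"
    and open_U: "open U" and U_nonempty: "U \<noteq> {}" and U_W: "U \<subseteq> W"
    and U_maps: "i \<in> D \<Longrightarrow> \<phi> i ` U \<subseteq> U"
    and U_disjoint: "i \<in> D \<Longrightarrow> j \<in> D \<Longrightarrow> i \<noteq> j \<Longrightarrow> \<phi> i ` U \<inter> \<phi> j ` U = {}"
begin

abbreviation scale :: "'i list \<Rightarrow> 'a \<Rightarrow> real" where
  "scale \<equiv> word_scale (\<lambda>i x. norm (\<phi>' i x)) \<phi>"

lemma K_W: "K \<subseteq> W"
  using \<epsilon> by (auto simp: W_eq)

lemma ball_W: "x \<in> K \<Longrightarrow> ball x \<epsilon> \<subseteq> W"
  by (auto simp: W_eq)

lemma X_W: "X \<subseteq> W"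
  using X_K K_W by simp

lemma W_maps: assumes i: "i \<in> D" shows "\<phi> i ` W \<subseteq> W"
proof clarify
  fix x assume x: "x \<in> W"
  then obtain k where k: "k \<in> K" "dist k x < \<epsilon>" by (auto simp: W_eq)
  have "dist (\<phi> i k) (\<phi> i x) \<le> r * dist k x" using i x k(1) K_W by (intro contract) auto
  also have "\<dots> \<le> 1 * dist k x" using r by (intro mult_right_mono) auto
  finally have "\<phi> i x \<in> ball (\<phi> i k) \<epsilon>" using k(2) by simp
  then show "\<phi> i x \<in> W" using K_maps[OF i] k(1) ball_W by blast
qed

lemma X_maps: "i \<in> D \<Longrightarrow> \<phi> i ` X \<subseteq> X"
  using X_eq by blast

lemma word_W: "set I \<subseteq> D \<Longrightarrow> x \<in> W \<Longrightarrow> word_map \<phi> I x \<in> W"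
  and word_X: "set I \<subseteq> D \<Longrightarrow> x \<in> X \<Longrightarrow> word_map \<phi> I x \<in> X"
  and word_U: "set I \<subseteq> D \<Longrightarrow> x \<in> U \<Longrightarrow> word_map \<phi> I x \<in> U"
  by (rule word_map_invariant; use W_maps X_maps U_maps in blast)+

lemma word_contract:
  assumes "set I \<subseteq> D" "x \<in> W" "y \<in> W"
  shows "dist (word_map \<phi> I x) (word_map \<phi> I y) \<le> r ^ length I * dist x y"
  using assms(1)
proof (induction I)
  case (Cons i I)
  have "dist (word_map \<phi> (i # I) x) (word_map \<phi> (i # I) y)
      \<le> r * dist (word_map \<phi> I x) (word_map \<phi> I y)"
    using Cons.prems assms(2,3) by (auto intro!: contract word_W)
  also have "\<dots> \<le> r * (r ^ length I * dist x y)" using Cons r by (intro mult_left_mono) auto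
  finally show ?case by (simp add: mult_ac)
qed simp

lemma word_inj: "set I \<subseteq> D \<Longrightarrow> inj_on (word_map \<phi> I) W"
proof (induction I)
  case (Cons i I)
  have "inj_on (\<phi> i) (word_map \<phi> I ` W)"
    using Cons.prems inj_W by (intro inj_on_subset[OF inj_W]) (auto intro: word_W)
  then show ?case unfolding word_map.simps using Cons by (intro comp_inj_on) auto
qed simp

lemma word_deriv:
  assumes "set I \<subseteq> D" "x \<in> W"
  shows "\<exists>F. (word_map \<phi> I has_derivative F) (at x) \<and> (\<forall>h. norm (F h) = scale I x * norm h)"
  using assms(1)
proof (induction I)
  case Nil
  show ?case by (intro exI[of _ "\<lambda>h. h"]) (simp add: id_def)
next
  case (Cons i I)
  then obtain F where F: "(word_map \<phi> I has_derivative F) (at x)" "\<And>h. norm (F h) = scale I x * norm h"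
    by auto
  have y: "i \<in> D" "word_map \<phi> I x \<in> W" using Cons.prems assms(2) by (auto intro: word_W)
  have "(word_map \<phi> (i # I) has_derivative (blinfun_apply (\<phi>' i (word_map \<phi> I x)) \<circ> F)) (at x)"
    using diff_chain_at[OF F(1) deriv[OF y]] by simp
  moreover have "norm ((blinfun_apply (\<phi>' i (word_map \<phi> I x)) \<circ> F) h) = scale (i # I) x * norm h" for h
    by (simp add: conformal[OF y] F(2))
  ultimately show ?case by blast
qed

lemma scale_bounds:
  assumes "set I \<subseteq> D" "x \<in> W"
  shows "m ^ length I \<le> scale I x" "scale I x \<le> r ^ length I"
proof -
  have "m ^ length I \<le> scale I x \<and> scale I x \<le> r ^ length I" using assms(1)
  proof (induction I)
    case (Cons i I)
    have y: "i \<in> D" "word_map \<phi> I x \<in> W" using Cons.prems assms(2) by (auto intro: word_W)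
    have IH: "m ^ length I \<le> scale I x" "scale I x \<le> r ^ length I" using Cons by auto
    have "m * m ^ length I \<le> norm (\<phi>' i (word_map \<phi> I x)) * scale I x"
      using norm_ge[OF y] IH(1) m by (intro mult_mono) auto
    moreover have "norm (\<phi>' i (word_map \<phi> I x)) * scale I x \<le> r * r ^ length I"
      using norm_le[OF y] IH(2) r zero_le_power[of m "length I"] m IH(1)
      by (intro mult_mono) (auto simp del: zero_le_power)
    ultimately show ?case by simp
  qed simp
  then show "m ^ length I \<le> scale I x" "scale I x \<le> r ^ length I" by auto
qed

lemma scale_pos: "set I \<subseteq> D \<Longrightarrow> x \<in> W \<Longrightarrow> 0 < scale I x"
  using scale_bounds(1)[of I x] zero_less_power[OF m, of "length I"] by linarith

lemma bounded_W: "bounded W"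
proof -
  obtain B where B: "\<And>x. x \<in> K \<Longrightarrow> norm x \<le> B"
    using compact_imp_bounded[OF compact_K] by (auto simp: bounded_iff)
  have "norm y \<le> B + \<epsilon>" if "y \<in> W" for y
  proof -
    obtain x where x: "x \<in> K" "dist x y < \<epsilon>" using \<open>y \<in> W\<close> by (auto simp: W_eq)
    then show ?thesis using B[OF x(1)] norm_triangle_ineq2[of y x] by (simp add: dist_norm norm_minus_commute)
  qed
  then show ?thesis by (auto simp: bounded_iff)
qed

definition distortion :: real where
  "distortion = exp (c / m * diameter W powr \<alpha> / (1 - r powr \<alpha>))"

lemma r_powr: "0 < r powr \<alpha>" "r powr \<alpha> < 1"
  using r \<alpha> powr_less_mono2[of \<alpha> r 1] by auto

lemma distortion_ge_1: "1 \<le> distortion"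
  unfolding distortion_def using r_powr c m by simp

text \<open>The orbits of \<open>x\<close> and \<open>y\<close> approach each other geometrically, so by the Hoelder condition the
successive quotients of derivative norms are at most \<open>exp (b * q ^ j)\<close> with \<open>q = r powr \<alpha> < 1\<close>, and
their product is bounded.\<close>
lemma bounded_distortion:
  assumes I: "set I \<subseteq> D" and x: "x \<in> W" and y: "y \<in> W"
  shows "scale I x \<le> distortion * scale I y"
proof -
  define b where "b = c / m * diameter W powr \<alpha>"
  define q where "q = r powr \<alpha>"
  have b: "0 \<le> b" using c m by (simp add: b_def)
  have q: "0 < q" "q < 1" using r_powr by (auto simp: q_def)
  have "scale I x \<le> exp (b * (\<Sum>j<length I. q ^ j)) * scale I y" using I
  proof (induction I)
    case (Cons i I)
    let ?x = "word_map \<phi> I x" and ?y = "word_map \<phi> I y"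
    have xy: "i \<in> D" "?x \<in> W" "?y \<in> W" using Cons.prems x y by (auto intro: word_W)
    have "dist ?x ?y \<le> r ^ length I * dist x y" using Cons.prems x y by (intro word_contract) auto
    also have "\<dots> \<le> r ^ length I * diameter W"
      using r diameter_bounded_bound[OF bounded_W x y] by (intro mult_left_mono) auto
    finally have "dist ?x ?y powr \<alpha> \<le> (r ^ length I * diameter W) powr \<alpha>"
      using \<alpha> by (intro powr_mono2) auto
    also have "\<dots> = q ^ length I * diameter W powr \<alpha>"
      using r diameter_ge_0[OF bounded_W]
      by (simp add: powr_mult q_def powr_realpow[symmetric] powr_powr mult.commute)
    finally have d: "c * dist ?x ?y powr \<alpha> \<le> c * (q ^ length I * diameter W powr \<alpha>)"
      using c by (intro mult_left_mono) auto
    have "norm (\<phi>' i ?x) \<le> norm (\<phi>' i ?y) + c * dist ?x ?y powr \<alpha>"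
      using holder[OF xy] by linarith
    also have "\<dots> \<le> norm (\<phi>' i ?y) + m * (b * q ^ length I)"
      using d m by (simp add: b_def mult_ac)
    also have "\<dots> \<le> norm (\<phi>' i ?y) + norm (\<phi>' i ?y) * (b * q ^ length I)"
      using norm_ge[OF xy(1,3)] b q by (intro add_left_mono mult_right_mono) auto
    also have "\<dots> = norm (\<phi>' i ?y) * (1 + b * q ^ length I)" by (simp add: algebra_simps)
    also have "\<dots> \<le> norm (\<phi>' i ?y) * exp (b * q ^ length I)"
      by (intro mult_left_mono exp_ge_add_one_self) auto
    finally have step: "norm (\<phi>' i ?x) \<le> exp (b * q ^ length I) * norm (\<phi>' i ?y)"
      by (simp add: mult.commute)
    have "scale (i # I) x \<le> (exp (b * q ^ length I) * norm (\<phi>' i ?y)) *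
        (exp (b * (\<Sum>j<length I. q ^ j)) * scale I y)"
      unfolding word_scale.simps
      using step Cons.IH Cons.prems less_imp_le[OF scale_pos[of I x]] x by (intro mult_mono) auto
    also have "\<dots> = exp (b * (\<Sum>j<length (i # I). q ^ j)) * scale (i # I) y"
      by (simp add: distrib_left exp_add mult_ac)
    finally show ?case .
  qed simp
  also have "\<dots> \<le> distortion * scale I y"
  proof (intro mult_right_mono)
    have "(\<Sum>j<length I. q ^ j) \<le> (\<Sum>j. q ^ j)"
      using q by (intro sum_le_suminf summable_geometric) auto
    also have "\<dots> = 1 / (1 - q)" using q by (simp add: suminf_geometric)
    finally have "b * (\<Sum>j<length I. q ^ j) \<le> b * (1 / (1 - q))" using b by (intro mult_left_mono)
    then show "exp (b * (\<Sum>j<length I. q ^ j)) \<le> distortion"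
      by (simp add: distortion_def b_def q_def)
  qed (use scale_pos[OF I y] in simp)
  finally show ?thesis .
qed

text \<open>A reference point for the scales; by bounded distortion its choice affects them by a bounded factor only.\<close>
definition base :: 'a where "base = (SOME x. x \<in> X)"

definition lam :: "'i list \<Rightarrow> real" where "lam I = scale I base"

lemma base_X: "base \<in> X"
  using X_nonempty by (auto simp: base_def intro: someI)

lemma base_W: "base \<in> W"
  using base_X X_W by blast

lemma lam_pos: "set I \<subseteq> D \<Longrightarrow> 0 < lam I"
  by (simp add: lam_def scale_pos base_W)

lemma lam_bounds:
  "set I \<subseteq> D \<Longrightarrow> m ^ length I \<le> lam I" "set I \<subseteq> D \<Longrightarrow> lam I \<le> r ^ length I"
  by (simp_all add: lam_def scale_bounds base_W)

lemma scale_le_lam: "set I \<subseteq> D \<Longrightarrow> x \<in> W \<Longrightarrow> scale I x \<le> distortion * lam I"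
  and lam_le_scale: "set I \<subseteq> D \<Longrightarrow> x \<in> W \<Longrightarrow> lam I \<le> distortion * scale I x"
  by (simp_all add: lam_def bounded_distortion base_W)

sublocale lam: quasi_multiplicative D lam distortion
proof
  fix I J assume IJ: "set I \<subseteq> D" "set J \<subseteq> D"
  have y: "word_map \<phi> J base \<in> W" using IJ base_W by (intro word_W)
  have eq: "lam (I @ J) = scale I (word_map \<phi> J base) * lam J"
    by (simp add: lam_def word_scale_append)
  show "lam (I @ J) \<le> distortion * lam I * lam J"
    unfolding eq using scale_le_lam[OF IJ(1) y] lam_pos[OF IJ(2)] by (intro mult_right_mono) auto
  have "lam I * lam J \<le> (distortion * scale I (word_map \<phi> J base)) * lam J"
    using lam_le_scale[OF IJ(1) y] lam_pos[OF IJ(2)] by (intro mult_right_mono) auto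
  then show "lam I * lam J \<le> distortion * lam (I @ J)" unfolding eq by (simp add: mult_ac)
qed (simp_all add: finite_D D_nonempty distortion_ge_1 lam_pos)

lemma word_Lipschitz_ball:
  assumes I: "set I \<subseteq> D" and x: "x \<in> K" and a: "a \<in> ball x \<epsilon>" and b: "b \<in> ball x \<epsilon>"
  shows "dist (word_map \<phi> I a) (word_map \<phi> I b) \<le> distortion * lam I * dist a b"
proof -
  have "\<exists>F. \<forall>y\<in>ball x \<epsilon>. (word_map \<phi> I has_derivative F y) (at y) \<and> (\<forall>h. norm (F y h) = scale I y * norm h)"
    using word_deriv[OF I] ball_W[OF x] by (intro bchoice) blast
  then obtain F where F: "\<And>y. y \<in> ball x \<epsilon> \<Longrightarrow> (word_map \<phi> I has_derivative F y) (at y)"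
    "\<And>y h. y \<in> ball x \<epsilon> \<Longrightarrow> norm (F y h) = scale I y * norm h"
    by blast
  have "norm (word_map \<phi> I a - word_map \<phi> I b) \<le> distortion * lam I * norm (a - b)"
  proof (rule differentiable_bound[of "ball x \<epsilon>" "word_map \<phi> I" F])
    fix y assume y: "y \<in> ball x \<epsilon>"
    show "(word_map \<phi> I has_derivative F y) (at y within ball x \<epsilon>)"
      using F(1)[OF y] by (rule has_derivative_at_withinI)
    have "scale I y \<le> distortion * lam I" using y ball_W[OF x] by (intro scale_le_lam I) blast
    then show "onorm (F y) \<le> distortion * lam I"
      using lam_pos[OF I] distortion_ge_1 F(2)[OF y] by (intro onorm_bound) (auto intro: mult_right_mono)
  qed (use a b in auto)
  then show ?thesis by (simp add: dist_norm)
qed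

lemma ball_subset_word_image:
  assumes I: "set I \<subseteq> D" and sub: "ball x \<rho> \<subseteq> W" and \<rho>: "0 < \<rho>"
  shows "ball (word_map \<phi> I x) (lam I / distortion * \<rho>) \<subseteq> word_map \<phi> I ` ball x \<rho>"
proof -
  have "\<exists>F. \<forall>y\<in>ball x \<rho>. (word_map \<phi> I has_derivative F y) (at y) \<and> (\<forall>h. norm (F y h) = scale I y * norm h)"
    using word_deriv[OF I] sub by (intro bchoice) blast
  then obtain F where F: "\<And>y. y \<in> ball x \<rho> \<Longrightarrow> (word_map \<phi> I has_derivative F y) (at y)"
    "\<And>y h. y \<in> ball x \<rho> \<Longrightarrow> norm (F y h) = scale I y * norm h"
    by blast
  show ?thesis
  proof (rule ball_subset_image_ball[OF _ F(1)])
    show "inj_on (word_map \<phi> I) (ball x \<rho>)" using word_inj[OF I] sub by (rule inj_on_subset)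
    show "0 < lam I / distortion" using lam_pos[OF I] distortion_ge_1 by simp
    fix y h assume y: "y \<in> ball x \<rho>"
    have "lam I \<le> distortion * scale I y" using y sub by (intro lam_le_scale I) blast
    then have "lam I / distortion \<le> scale I y" using distortion_ge_1 by (simp add: pos_divide_le_eq mult.commute)
    then show "lam I / distortion * norm h \<le> norm (F y h)"
      unfolding F(2)[OF y] by (intro mult_right_mono) auto
  qed (use \<rho> in auto)
qed

text \<open>\<open>W\<close> need be neither convex nor connected, so the mean value inequality applies at distances
below \<open>\<epsilon>\<close> only. The last \<open>n\<close> letters of a long word bring any two points of \<open>X\<close> that close, and the
scale of these letters is bounded below by \<open>m ^ n\<close>. Words shorter than \<open>n\<close> have scale at least
\<open>m ^ n\<close> anyway.\<close>
lemma cylinder_size: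
  obtains C where "0 < C" "\<And>I x y. set I \<subseteq> D \<Longrightarrow> x \<in> X \<Longrightarrow> y \<in> X \<Longrightarrow>
    dist (word_map \<phi> I x) (word_map \<phi> I y) \<le> C * lam I"
proof -
  have bX: "bounded X" using compact_X by (rule compact_imp_bounded)
  have dX: "0 \<le> diameter X" by (rule diameter_ge_0[OF bX])
  have mr: "m < 1"
  proof -
    obtain i where "i \<in> D" using D_nonempty by blast
    then show ?thesis using norm_ge norm_le base_W r by force
  qed
  obtain n where n: "r ^ n < \<epsilon> / (diameter X + 1)"
    using real_arch_pow_inv[of "\<epsilon> / (diameter X + 1)" r] r \<epsilon> dX by auto
  have n': "r ^ n * diameter X < \<epsilon>"
  proof -
    have "r ^ n * diameter X \<le> r ^ n * (diameter X + 1)" using r by (intro mult_left_mono) auto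
    also have "\<dots> < \<epsilon>" using n dX by (simp add: pos_less_divide_eq)
    finally show ?thesis .
  qed
  have mn: "0 < m ^ n" using m by simp
  define C where "C = distortion * \<epsilon> * distortion / m ^ n + diameter X / m ^ n"
  have pos1: "0 < distortion * \<epsilon> * distortion / m ^ n" using distortion_ge_1 \<epsilon> m by simp
  have pos2: "0 \<le> diameter X / m ^ n" using dX m by simp
  show ?thesis
  proof (rule that)
    show "0 < C" using pos1 pos2 by (simp add: C_def)
    fix I x y assume I: "set I \<subseteq> D" and x: "x \<in> X" and y: "y \<in> X"
    have dxy: "dist x y \<le> diameter X" by (rule diameter_bounded_bound[OF bX x y])
    have lamI: "0 < lam I" by (rule lam_pos[OF I])
    show "dist (word_map \<phi> I x) (word_map \<phi> I y) \<le> C * lam I"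
    proof (cases "n \<le> length I")
      case True
      define I' where "I' = take (length I - n) I"
      define J where "J = drop (length I - n) I"
      have IJ: "I = I' @ J" "length J = n" using True by (auto simp: I'_def J_def)
      have D: "set I' \<subseteq> D" "set J \<subseteq> D" using I IJ(1) by auto
      let ?x = "word_map \<phi> J x" and ?y = "word_map \<phi> J y"
      have "dist ?x ?y \<le> r ^ n * dist x y" using word_contract[OF D(2)] x y X_W IJ(2) by auto
      also have "\<dots> \<le> r ^ n * diameter X" using r dxy by (intro mult_left_mono) auto
      finally have d: "dist ?x ?y < \<epsilon>" using n' by simp
      have "?x \<in> K" using word_X[OF D(2) x] X_K by blast
      then have "dist (word_map \<phi> I' ?x) (word_map \<phi> I' ?y) \<le> distortion * lam I' * dist ?x ?y"
        using d \<epsilon> by (intro word_Lipschitz_ball[OF D(1)]) auto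
      also have "\<dots> \<le> distortion * lam I' * \<epsilon>"
        using d distortion_ge_1 lam_pos[OF D(1)] by (intro mult_left_mono) auto
      also have "\<dots> \<le> distortion * (distortion * lam I / m ^ n) * \<epsilon>"
      proof -
        have "lam I' * m ^ n \<le> lam I' * lam J"
          using lam_bounds(1)[OF D(2)] IJ(2) lam_pos[OF D(1)] by (intro mult_left_mono) auto
        also have "\<dots> \<le> distortion * lam I" using lam.w_append_ge[OF D] IJ(1) by simp
        finally have "lam I' \<le> distortion * lam I / m ^ n" using mn by (simp add: pos_le_divide_eq)
        then show ?thesis using distortion_ge_1 \<epsilon> by (intro mult_right_mono mult_left_mono) auto
      qed
      also have "\<dots> \<le> C * lam I"
      proof -
        have "0 \<le> diameter X / m ^ n * lam I" using pos2 lamI by (intro mult_nonneg_nonneg) auto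
        then show ?thesis by (simp add: C_def algebra_simps)
      qed
      finally show ?thesis by (simp add: IJ(1) word_map_append)
    next
      case False
      have "dist (word_map \<phi> I x) (word_map \<phi> I y) \<le> diameter X"
        using word_X[OF I] x y by (intro diameter_bounded_bound[OF bX])
      also have "\<dots> = diameter X / m ^ n * m ^ n" using m by simp
      also have "\<dots> \<le> diameter X / m ^ n * lam I"
      proof (rule mult_left_mono[OF _ pos2])
        have "m ^ n \<le> m ^ length I" using False m mr by (intro power_decreasing) auto
        then show "m ^ n \<le> lam I" using lam_bounds(1)[OF I] by linarith
      qed
      also have "\<dots> \<le> C * lam I"
      proof -
        have "0 \<le> distortion * \<epsilon> * distortion / m ^ n * lam I" using pos1 lamI by (intro mult_nonneg_nonneg) auto
        then show ?thesis by (simp add: C_def algebra_simps)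
      qed
      finally show ?thesis .
    qed
  qed
qed

section \<open>The open set condition and the dimension of the attractor\<close>

lemma incomparable_disjoint:
  "set I \<subseteq> D \<Longrightarrow> set J \<subseteq> D \<Longrightarrow> \<not> prefix I J \<Longrightarrow> \<not> prefix J I \<Longrightarrow>
    word_map \<phi> I ` U \<inter> word_map \<phi> J ` U = {}"
proof (induction I arbitrary: J)
  case (Cons i I)
  then obtain j J' where J: "J = j # J'" by (cases J) auto
  show ?case
  proof (cases "i = j")
    case False
    have "word_map \<phi> (i # I) ` U \<subseteq> \<phi> i ` U" "word_map \<phi> J ` U \<subseteq> \<phi> j ` U"
      using Cons.prems word_U by (auto simp: J)
    then show ?thesis using U_disjoint[of i j] False Cons.prems by (auto simp: J)
  next
    case True
    have dis: "word_map \<phi> I ` U \<inter> word_map \<phi> J' ` U = {}"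
      using Cons.prems True by (intro Cons.IH) (auto simp: J)
    have "word_map \<phi> I ` U \<subseteq> W" "word_map \<phi> J' ` U \<subseteq> W"
      using Cons.prems word_U U_W by (auto simp: J)
    then have "\<phi> i ` (word_map \<phi> I ` U) \<inter> \<phi> i ` (word_map \<phi> J' ` U) = {}"
      using inj_on_image_Int[OF inj_W[of i], of "word_map \<phi> I ` U" "word_map \<phi> J' ` U"] dis Cons.prems
      by auto
    then show ?thesis by (simp add: J True image_comp)
  qed
qed simp

text \<open>Applying one of the maps often enough to a point of \<open>U\<close> and to a point of \<open>X\<close> brings them together,
while they stay in \<open>U\<close> and in \<open>X\<close>.\<close>
lemma U_near_X:
  obtains x u \<rho> where "x \<in> X" "0 < \<rho>" "ball u \<rho> \<subseteq> U" "u \<in> ball x \<epsilon>"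
proof -
  obtain u where u: "u \<in> U" using U_nonempty by blast
  obtain i where i: "i \<in> D" using D_nonempty by blast
  obtain n where n: "r ^ n < \<epsilon> / (dist base u + 1)"
    using real_arch_pow_inv[of "\<epsilon> / (dist base u + 1)" r] r \<epsilon> by (auto simp: add_nonneg_pos)
  define I where "I = replicate n i"
  have I: "set I \<subseteq> D" "length I = n" using i by (auto simp: I_def)
  have "dist (word_map \<phi> I base) (word_map \<phi> I u) \<le> r ^ n * dist base u"
    using word_contract[OF I(1) base_W, of u] u U_W I(2) by auto
  also have "\<dots> \<le> r ^ n * (dist base u + 1)" using r by (intro mult_left_mono) auto
  also have "\<dots> < \<epsilon>" using n by (simp add: pos_less_divide_eq add_nonneg_pos)
  finally have "word_map \<phi> I u \<in> ball (word_map \<phi> I base) \<epsilon>" by simp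
  moreover have "word_map \<phi> I u \<in> U" by (rule word_U[OF I(1) u])
  then obtain \<rho> where "0 < \<rho>" "ball (word_map \<phi> I u) \<rho> \<subseteq> U"
    using open_U open_contains_ball by blast
  ultimately show ?thesis using that word_X[OF I(1) base_X] by blast
qed

text \<open>The images of a fixed ball in \<open>U\<close> under the maps of incomparable words are disjoint, and for words of
scale about \<open>\<delta>\<close> each of them contains a ball of radius \<open>a * \<delta>\<close>. If the cylinders also meet a ball
of radius \<open>\<delta>\<close>, these balls lie within distance of order \<open>\<delta>\<close> of its centre.\<close>
lemma antichain_card_bound:
  assumes \<eta>: "0 < \<eta>"
  obtains N where "0 < N" "\<And>T p \<delta>. finite T \<Longrightarrow> 0 < \<delta> \<Longrightarrow>
    (\<And>J. J \<in> T \<Longrightarrow> set J \<subseteq> D \<and> lam J \<le> \<delta> \<and> \<eta> * \<delta> \<le> lam J \<and> word_map \<phi> J ` X \<inter> ball p \<delta> \<noteq> {}) \<Longrightarrow>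
    (\<And>I J. I \<in> T \<Longrightarrow> J \<in> T \<Longrightarrow> prefix I J \<Longrightarrow> I = J) \<Longrightarrow> real (card T) \<le> N"
proof -
  obtain x u \<rho> where u: "x \<in> X" "0 < \<rho>" "ball u \<rho> \<subseteq> U" "u \<in> ball x \<epsilon>" by (rule U_near_X)
  obtain C where C: "0 < C" "\<And>I x y. set I \<subseteq> D \<Longrightarrow> x \<in> X \<Longrightarrow> y \<in> X \<Longrightarrow>
    dist (word_map \<phi> I x) (word_map \<phi> I y) \<le> C * lam I" by (rule cylinder_size) blast
  define a where "a = \<eta> / distortion * \<rho>"
  define R where "R = 1 + C + distortion * \<epsilon> + a"
  have a: "0 < a" using \<eta> u(2) distortion_ge_1 by (simp add: a_def)
  have R: "0 < R" using a C(1) distortion_ge_1 \<epsilon> by (simp add: R_def add_pos_pos)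
  have uW: "ball u \<rho> \<subseteq> W" using u(3) U_W by blast
  show ?thesis
  proof (rule that)
    show "0 < (R / a) ^ DIM('a)" using a R by simp
    fix T :: "'i list set" and p \<delta>
    assume T: "finite T" and \<delta>: "0 < (\<delta>::real)"
      and TJ: "\<And>J. J \<in> T \<Longrightarrow> set J \<subseteq> D \<and> lam J \<le> \<delta> \<and> \<eta> * \<delta> \<le> lam J \<and> word_map \<phi> J ` X \<inter> ball p \<delta> \<noteq> {}"
      and anti: "\<And>I J. I \<in> T \<Longrightarrow> J \<in> T \<Longrightarrow> prefix I J \<Longrightarrow> I = J"
    have sub: "ball (word_map \<phi> J u) (a * \<delta>) \<subseteq> word_map \<phi> J ` U" if "J \<in> T" for J
    proof -
      have J: "set J \<subseteq> D" "\<eta> * \<delta> \<le> lam J" using TJ[OF that] by auto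
      have "\<eta> * \<delta> * (\<rho> / distortion) \<le> lam J * (\<rho> / distortion)"
        using J(2) u(2) distortion_ge_1 by (intro mult_right_mono) auto
      then have "a * \<delta> \<le> lam J / distortion * \<rho>" by (simp add: a_def mult_ac)
      then have "ball (word_map \<phi> J u) (a * \<delta>) \<subseteq> ball (word_map \<phi> J u) (lam J / distortion * \<rho>)"
        by (rule subset_ball)
      then show ?thesis using ball_subset_word_image[OF J(1) uW u(2)] u(3) by blast
    qed
    have "real (card T) \<le> (R * \<delta> / (a * \<delta>)) ^ DIM('a)"
    proof (rule card_disjoint_balls_le[OF T])
      show "disjoint_family_on (\<lambda>J. ball (word_map \<phi> J u) (a * \<delta>)) T"
        unfolding disjoint_family_on_def
      proof (intro ballI impI)
        fix I J assume IJ: "I \<in> T" "J \<in> T" "I \<noteq> J"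
        then have "word_map \<phi> I ` U \<inter> word_map \<phi> J ` U = {}"
          using TJ anti by (intro incomparable_disjoint) blast+
        then show "ball (word_map \<phi> I u) (a * \<delta>) \<inter> ball (word_map \<phi> J u) (a * \<delta>) = {}"
          using sub[OF IJ(1)] sub[OF IJ(2)] by blast
      qed
      show "0 < a * \<delta>" "0 < R * \<delta>" using a R \<delta> by auto
      fix J assume "J \<in> T"
      then have J: "set J \<subseteq> D" "lam J \<le> \<delta>" "word_map \<phi> J ` X \<inter> ball p \<delta> \<noteq> {}" using TJ by auto
      then obtain y where y: "y \<in> X" "dist p (word_map \<phi> J y) < \<delta>" by auto
      have "dist (word_map \<phi> J y) (word_map \<phi> J x) \<le> C * lam J" by (rule C(2)[OF J(1) y(1) u(1)])
      also have "\<dots> \<le> C * \<delta>" using J(2) C(1) by (intro mult_left_mono) auto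
      finally have d1: "dist (word_map \<phi> J y) (word_map \<phi> J x) \<le> C * \<delta>" .
      have "dist (word_map \<phi> J x) (word_map \<phi> J u) \<le> distortion * lam J * dist x u"
        using u(1,4) X_K \<epsilon> by (intro word_Lipschitz_ball[OF J(1), of x]) auto
      also have "\<dots> \<le> distortion * \<delta> * \<epsilon>"
        using J(2) u(4) distortion_ge_1 \<delta> lam_pos[OF J(1)] by (intro mult_mono) auto
      finally have d2: "dist (word_map \<phi> J x) (word_map \<phi> J u) \<le> distortion * \<epsilon> * \<delta>" by (simp add: mult_ac)
      show "ball (word_map \<phi> J u) (a * \<delta>) \<subseteq> ball p (R * \<delta>)"
      proof
        fix q assume "q \<in> ball (word_map \<phi> J u) (a * \<delta>)"
        then have "dist (word_map \<phi> J u) q < a * \<delta>" by simp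
        moreover have "dist p q \<le> dist p (word_map \<phi> J y) + dist (word_map \<phi> J y) (word_map \<phi> J x)
            + dist (word_map \<phi> J x) (word_map \<phi> J u) + dist (word_map \<phi> J u) q"
          using dist_triangle[of p q "word_map \<phi> J y"]
            dist_triangle[of "word_map \<phi> J y" q "word_map \<phi> J x"]
            dist_triangle[of "word_map \<phi> J x" q "word_map \<phi> J u"] by linarith
        ultimately have "dist p q < \<delta> + C * \<delta> + distortion * \<epsilon> * \<delta> + a * \<delta>"
          using y(2) d1 d2 by linarith
        then show "q \<in> ball p (R * \<delta>)" by (simp add: R_def algebra_simps)
      qed
    qed
    then show "real (card T) \<le> (R / a) ^ DIM('a)" using \<delta> by simp
  qed
qed

end


context conformal_system
begin

lemma X_words: "x \<in> X \<Longrightarrow> \<exists>W\<in>words D n. x \<in> word_map \<phi> W ` X"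
proof (induction n)
  case (Suc n)
  then obtain W y where W: "W \<in> words D n" "y \<in> X" "x = word_map \<phi> W y" by blast
  have "y \<in> (\<Union>i\<in>D. \<phi> i ` X)" using W(2) X_eq by blast
  then obtain i y' where i: "i \<in> D" "y' \<in> X" "y = \<phi> i y'" by blast
  have "x = word_map \<phi> (W @ [i]) y'" using W i by (simp add: word_map_append)
  moreover have "W @ [i] \<in> words D (Suc n)" using W(1) i(1) by (simp add: words_def)
  ultimately show ?case using i(2) by blast
qed simp

lemma word_map_take:
  assumes I: "set I \<subseteq> D" and x: "x \<in> word_map \<phi> I ` X"
  shows "x \<in> word_map \<phi> (take j I) ` X"
proof -
  obtain y where y: "y \<in> X" "x = word_map \<phi> I y" using x by blast
  have "x = word_map \<phi> (take j I) (word_map \<phi> (drop j I) y)"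
    using y(2) word_map_append[of \<phi> "take j I" "drop j I"] by simp
  moreover have "word_map \<phi> (drop j I) y \<in> X"
    using I y(1) by (intro word_X) (auto dest: in_set_dropD)
  ultimately show ?thesis by blast
qed

text \<open>The first prefix with scale at most \<open>\<delta>\<close> has scale comparable to \<open>\<delta>\<close>, since its last letter
contributes at least the factor \<open>m / distortion\<close>.\<close>
lemma stopping_prefix:
  assumes I: "set I \<subseteq> D" and \<delta>: "lam I \<le> \<delta>"
  obtains j where "j \<le> length I" "lam (take j I) \<le> \<delta>" "\<And>i. i < j \<Longrightarrow> \<delta> < lam (take i I)"
    "take j I \<noteq> [] \<Longrightarrow> m / distortion * \<delta> \<le> lam (take j I)"
proof -
  define j where "j = (LEAST j. lam (take j I) \<le> \<delta>)"
  have ex: "lam (take (length I) I) \<le> \<delta>" using \<delta> by simp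
  have j: "lam (take j I) \<le> \<delta>" unfolding j_def by (rule LeastI[of "\<lambda>j. lam (take j I) \<le> \<delta>", OF ex])
  have jI: "j \<le> length I" unfolding j_def by (rule Least_le[of "\<lambda>j. lam (take j I) \<le> \<delta>", OF ex])
  have before: "\<delta> < lam (take i I)" if "i < j" for i
    using not_less_Least[of i "\<lambda>j. lam (take j I) \<le> \<delta>"] that by (simp add: j_def not_le)
  have "m / distortion * \<delta> \<le> lam (take j I)" if ne: "take j I \<noteq> []"
  proof -
    obtain i where i: "j = Suc i" using ne by (cases j) auto
    let ?J = "take i I"
    have eq: "take j I = ?J @ [I ! i]" using i jI by (simp add: take_Suc_conv_app_nth)
    have D: "set ?J \<subseteq> D" "set [I ! i] \<subseteq> D"
      using I jI i nth_mem[of i I] by (auto dest: in_set_takeD)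
    have "m * \<delta> \<le> lam [I ! i] * lam ?J"
      using before[of i] i lam_bounds(1)[OF D(2)] m lam_pos[OF D(1)] lam_pos[OF I] \<delta>
      by (intro mult_mono) auto
    then have "m * \<delta> \<le> distortion * lam (take j I)"
      using lam.w_append_ge[OF D] unfolding eq by (simp add: mult.commute)
    then show ?thesis using distortion_ge_1 by (simp add: field_simps)
  qed
  with jI j before show ?thesis by (rule that)
qed

lemma lam_Nil: "lam [] = 1"
  by (simp add: lam_def)

text \<open>The critical exponent of \<open>lam\<close> together with its Gibbs weight, which inherits quasi-multiplicativity
and exponential decay from \<open>lam I powr s\<close>.\<close>
lemma gibbs_weight_for_scales:
  assumes "2 \<le> card D"
  obtains s \<nu> A B \<rho> where "0 < s" "1 \<le> A" "gibbs_weight D \<nu> B \<rho>"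
    "\<And>I. set I \<subseteq> D \<Longrightarrow> lam I powr s \<le> A * \<nu> I"
    "\<And>I. set I \<subseteq> D \<Longrightarrow> \<nu> I \<le> A * lam I powr s"
proof -
  obtain s where s: "0 < s"
    "\<And>n. 1 \<le> distortion powr s * (\<Sum>I\<in>words D n. lam I powr s)"
    "\<And>n. (\<Sum>I\<in>words D n. lam I powr s) \<le> distortion powr s"
    using lam.pressure_zero[OF assms r lam_bounds(2)] by metis
  define P where "P = distortion powr s"
  define w where "w I = lam I powr s" for I
  interpret w: quasi_multiplicative D w P
    unfolding w_def P_def using s(1) by (intro lam.quasi_multiplicative_powr) simp
  obtain \<nu> where \<nu>: "\<And>I. set I \<subseteq> D \<Longrightarrow> \<nu> I = (\<Sum>i\<in>D. \<nu> (I @ [i]))"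
    "\<And>I. set I \<subseteq> D \<Longrightarrow> w I \<le> P * P * \<nu> I" "\<And>I. set I \<subseteq> D \<Longrightarrow> \<nu> I \<le> P * P * w I"
    by (rule w.gibbs_weight_exists[of P]) (use s w.C_ge_1 in \<open>auto simp: w.Z_def w_def P_def\<close>)
  define A where "A = P * P"
  define B where "B = A ^ 3 * P"
  define \<rho> where "\<rho> = r powr s"
  have A: "1 \<le> A" unfolding A_def using mult_mono[of 1 P 1 P] w.C_ge_1 by simp
  have AB: "A \<le> B"
    using A w.C_ge_1 mult_mono[of "A ^ 1" "A ^ 3" 1 P] power_increasing[of 1 3 A] by (simp add: B_def)
  have \<nu>w: "w I \<le> A * \<nu> I" "\<nu> I \<le> A * w I" if "set I \<subseteq> D" for I
    using \<nu>(2,3)[OF that] by (simp_all add: A_def)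
  have pos: "0 < \<nu> I" if "set I \<subseteq> D" for I
    using \<nu>w(1)[OF that] w.w_pos[OF that] A by (smt (verit) zero_less_mult_iff)
  have "gibbs_weight D \<nu> B \<rho>"
  proof
    show "finite D" "D \<noteq> {}" using finite_D D_nonempty by auto
    show "1 \<le> B" using A AB by linarith
    show "0 < \<rho>" "\<rho> < 1" unfolding \<rho>_def using r s(1) powr_less_mono2[of s r 1] by auto
    fix I assume I: "set I \<subseteq> D"
    show "0 < \<nu> I" by (rule pos[OF I])
    show "\<nu> I = (\<Sum>i\<in>D. \<nu> (I @ [i]))" by (rule \<nu>(1)[OF I])
    have "w I \<le> (r ^ length I) powr s"
      unfolding w_def using lam_bounds(2)[OF I] lam_pos[OF I] s(1) by (intro powr_mono2) auto
    also have "\<dots> = \<rho> ^ length I"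
      using r by (simp add: \<rho>_def powr_realpow[symmetric] powr_powr mult.commute)
    finally have "A * w I \<le> B * \<rho> ^ length I"
      using A AB w.w_pos[OF I] by (intro mult_mono) auto
    then show "\<nu> I \<le> B * \<rho> ^ length I" using \<nu>w(2)[OF I] by linarith
    fix J assume J: "set J \<subseteq> D"
    have IJ: "set (I @ J) \<subseteq> D" using I J by simp
    have "\<nu> (I @ J) \<le> A * (P * w I * w J)"
      using order.trans[OF \<nu>w(2)[OF IJ] mult_left_mono[OF w.w_append_le[OF I J]]] A by simp
    also have "\<dots> = A * P * (w I * w J)" by simp
    also have "\<dots> \<le> A * P * ((A * \<nu> I) * (A * \<nu> J))"
      using \<nu>w(1)[OF I] \<nu>w(1)[OF J] A w.C_pos w.w_pos[OF I] w.w_pos[OF J]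
      by (intro mult_left_mono mult_mono) auto
    finally show "\<nu> (I @ J) \<le> B * \<nu> I * \<nu> J" by (simp add: B_def power3_eq_cube mult_ac)
    have "\<nu> I * \<nu> J \<le> (A * w I) * (A * w J)"
      using \<nu>w(2)[OF I] \<nu>w(2)[OF J] A pos[OF I] pos[OF J] w.w_pos[OF I] by (intro mult_mono) auto
    also have "\<dots> = A * A * (w I * w J)" by simp
    also have "\<dots> \<le> A * A * (P * (A * \<nu> (I @ J)))"
      using order.trans[OF w.w_append_ge[OF I J] mult_left_mono[OF \<nu>w(1)[OF IJ]]] A w.C_pos
      by (intro mult_left_mono) auto
    finally show "\<nu> I * \<nu> J \<le> B * \<nu> (I @ J)" by (simp add: B_def power3_eq_cube mult_ac)
  qed
  then show ?thesis using that[of s A \<nu> B \<rho>] s(1) A \<nu>w by (simp add: w_def)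
qed

end

locale conformal_gibbs = conformal_system K W X U D \<phi> \<phi>' \<epsilon> r m c \<alpha> + nu: gibbs_weight D \<nu> B \<rho>
  for K W X U :: "'a::euclidean_space set" and D :: "'i set" and \<phi> \<phi>' \<epsilon> r m c \<alpha> \<nu> B \<rho> +
  fixes s A :: real
  assumes s: "0 < s" and A: "1 \<le> A"
    and lam_le_nu: "set I \<subseteq> D \<Longrightarrow> lam I powr s \<le> A * \<nu> I"
    and nu_le_lam: "set I \<subseteq> D \<Longrightarrow> \<nu> I \<le> A * lam I powr s"
begin

lemma nu_Nil_pos: "0 < \<nu> []"
  by (simp add: nu.w_pos)

text \<open>Mass distribution principle. Every word of a large length \<open>n\<close> has its base point in some ball of the
cover, and hence its stopping prefix in the set \<open>T k\<close> belonging to that ball. Summing \<open>\<nu>\<close> over these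
prefixes bounds the total mass \<open>\<nu> []\<close>, and each \<open>T k\<close> contributes at most a constant times
\<open>\<delta> k powr s\<close> because it has boundedly many elements.\<close>
lemma ball_cover_lower_bound:
  obtains c0 where "0 < c0" "\<And>F p \<delta>. finite F \<Longrightarrow> (\<And>k::nat. k \<in> F \<Longrightarrow> 0 < \<delta> k) \<Longrightarrow>
      X \<subseteq> (\<Union>k\<in>F. ball (p k) (\<delta> k)) \<Longrightarrow> c0 \<le> (\<Sum>k\<in>F. \<delta> k powr s)"
proof -
  have \<eta>: "0 < m / distortion" using m distortion_ge_1 by simp
  obtain N where N: "0 < N" "\<And>T p \<delta>. finite T \<Longrightarrow> 0 < \<delta> \<Longrightarrow>
    (\<And>J. J \<in> T \<Longrightarrow> set J \<subseteq> D \<and> lam J \<le> \<delta> \<and> m / distortion * \<delta> \<le> lam J \<and> word_map \<phi> J ` X \<inter> ball p \<delta> \<noteq> {}) \<Longrightarrow>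
    (\<And>I J. I \<in> T \<Longrightarrow> J \<in> T \<Longrightarrow> prefix I J \<Longrightarrow> I = J) \<Longrightarrow> real (card T) \<le> N"
    by (rule antichain_card_bound[OF \<eta>]) blast
  define c0 where "c0 = min 1 (\<nu> [] / (N * A))"
  show ?thesis
  proof (rule that)
    show "0 < c0" using nu_Nil_pos N(1) A by (simp add: c0_def)
    fix F :: "nat set" and p \<delta>
    assume F: "finite F" and \<delta>: "\<And>k. k \<in> F \<Longrightarrow> 0 < (\<delta> k::real)"
      and cover: "X \<subseteq> (\<Union>k\<in>F. ball (p k) (\<delta> k))"
    show "c0 \<le> (\<Sum>k\<in>F. \<delta> k powr s)"
    \<comment> \<open>Large balls are treated apart because for \<open>1 \<le> \<delta> k\<close> the stopping prefix may be empty, and then its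
scale \<open>1\<close> is not bounded below by a multiple of \<open>\<delta> k\<close>.\<close>
    proof (cases "\<exists>k\<in>F. 1 \<le> \<delta> k")
      case True
      then obtain k where k: "k \<in> F" "1 \<le> \<delta> k" by blast
      have "1 \<le> \<delta> k powr s" using k(2) s by (intro ge_one_powr_ge_zero) auto
      also have "\<dots> \<le> (\<Sum>k\<in>F. \<delta> k powr s)" using k(1) F by (intro member_le_sum) auto
      finally show ?thesis by (simp add: c0_def)
    next
      case False
      have "F \<noteq> {}" using cover X_nonempty by auto
      then have "0 < Min (\<delta> ` F)" using F \<delta> by simp
      then obtain n where n: "r ^ n < Min (\<delta> ` F)" using real_arch_pow_inv r by blast
      have n': "r ^ n \<le> \<delta> k" if "k \<in> F" for k
      proof -
        have "Min (\<delta> ` F) \<le> \<delta> k" using F that by (intro Min_le) auto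
        then show ?thesis using n by linarith
      qed
      define T where "T k = {J. set J \<subseteq> D \<and> length J \<le> n \<and> lam J \<le> \<delta> k \<and> m / distortion * \<delta> k \<le> lam J \<and>
        (\<forall>i<length J. \<delta> k < lam (take i J)) \<and> word_map \<phi> J ` X \<inter> ball (p k) (\<delta> k) \<noteq> {}}" for k
      have finT: "finite (T k)" for k
      proof (rule finite_subset)
        show "T k \<subseteq> {J. set J \<subseteq> D \<and> length J \<le> n}" by (auto simp: T_def)
      qed (rule finite_lists_length_le[OF finite_D])
      have cardT: "real (card (T k)) \<le> N" if k: "k \<in> F" for k
      proof (rule N(2)[OF finT \<delta>[OF k]])
        fix I J assume IJ: "I \<in> T k" "J \<in> T k" "prefix I J"
        show "I = J"
        proof (rule ccontr)
          assume "I \<noteq> J"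
          obtain J' where J': "J = I @ J'" using IJ(3) by (auto elim: prefixE)
          with \<open>I \<noteq> J\<close> have "length I < length J" "take (length I) J = I" by auto
          then show False using IJ(1,2) by (auto simp: T_def dest!: spec[of _ "length I"])
        qed
      qed (auto simp: T_def)
      have hitT: "\<exists>k\<in>F. \<exists>J\<in>T k. occurs_at J 0 I" if I: "I \<in> words D n" for I
      proof -
        have ID: "set I \<subseteq> D" "length I = n" using I by (auto simp: words_def)
        have xX: "word_map \<phi> I base \<in> X" by (rule word_X[OF ID(1) base_X])
        then obtain k where k: "k \<in> F" "word_map \<phi> I base \<in> ball (p k) (\<delta> k)" using cover by blast
        have "lam I \<le> \<delta> k" using lam_bounds(2)[OF ID(1)] n'[OF k(1)] ID(2) by simp
        from stopping_prefix[OF ID(1) this] obtain j where j: "j \<le> length I" "lam (take j I) \<le> \<delta> k"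
          "\<And>i. i < j \<Longrightarrow> \<delta> k < lam (take i I)"
          "take j I \<noteq> [] \<Longrightarrow> m / distortion * \<delta> k \<le> lam (take j I)" by blast
        have ne: "take j I \<noteq> []" using j(2) False k(1) lam_Nil by metis
        have "word_map \<phi> I base \<in> word_map \<phi> (take j I) ` X"
          by (rule word_map_take[OF ID(1)]) (use base_X in blast)
        then have "take j I \<in> T k"
          using j ne k ID by (auto simp: T_def min_def dest: in_set_takeD)
        moreover have "occurs_at (take j I) 0 I" using j(1) by (simp add: occurs_at_def)
        ultimately show ?thesis using k(1) by blast
      qed
      have "\<nu> [] = (\<Sum>I\<in>words D n. \<nu> I)" using nu.sum_extensions[of "[]" n] by simp
      also have "\<dots> \<le> (\<Sum>I\<in>words D n. \<Sum>k\<in>F. \<Sum>J\<in>T k. if occurs_at J 0 I then \<nu> I else 0)"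
      proof (rule sum_mono)
        fix I assume I: "I \<in> words D n"
        then obtain k J where kJ: "k \<in> F" "J \<in> T k" "occurs_at J 0 I" using hitT by blast
        have pos: "0 \<le> \<nu> I" using nu.w_pos[of I] I by (simp add: wordsD less_imp_le)
        have "\<nu> I = (if occurs_at J 0 I then \<nu> I else 0)" using kJ(3) by simp
        also have "\<dots> \<le> (\<Sum>J\<in>T k. if occurs_at J 0 I then \<nu> I else 0)"
          using kJ(2) finT pos by (intro member_le_sum) auto
        also have "\<dots> \<le> (\<Sum>k\<in>F. \<Sum>J\<in>T k. if occurs_at J 0 I then \<nu> I else 0)"
          using kJ(1) F pos by (intro member_le_sum) (auto intro!: sum_nonneg)
        finally show "\<nu> I \<le> \<dots>" .
      qed
      also have "\<dots> = (\<Sum>k\<in>F. \<Sum>I\<in>words D n. \<Sum>J\<in>T k. if occurs_at J 0 I then \<nu> I else 0)"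
        by (rule sum.swap)
      also have "\<dots> = (\<Sum>k\<in>F. \<Sum>J\<in>T k. \<Sum>I\<in>words D n. if occurs_at J 0 I then \<nu> I else 0)"
        by (rule sum.cong[OF refl], rule sum.swap)
      also have "\<dots> = (\<Sum>k\<in>F. \<Sum>J\<in>T k. \<nu> J)"
      proof (intro sum.cong refl)
        fix k J assume "J \<in> T k"
        then show "(\<Sum>I\<in>words D n. if occurs_at J 0 I then \<nu> I else 0) = \<nu> J"
          using nu.sum_hit[of J 0 n "[]", unfolded append_Nil] by (auto simp: T_def)
      qed
      also have "\<dots> \<le> (\<Sum>k\<in>F. \<Sum>J\<in>T k. A * \<delta> k powr s)"
      proof (intro sum_mono)
        fix k J assume "J \<in> T k"
        then have J: "set J \<subseteq> D" "lam J \<le> \<delta> k" by (auto simp: T_def)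
        have "\<nu> J \<le> A * lam J powr s" by (rule nu_le_lam[OF J(1)])
        also have "\<dots> \<le> A * \<delta> k powr s"
          using J lam_pos[OF J(1)] s A by (intro mult_left_mono powr_mono2) auto
        finally show "\<nu> J \<le> A * \<delta> k powr s" .
      qed
      also have "\<dots> = (\<Sum>k\<in>F. real (card (T k)) * (A * \<delta> k powr s))" by simp
      also have "\<dots> \<le> (\<Sum>k\<in>F. N * (A * \<delta> k powr s))"
        using A by (intro sum_mono mult_right_mono cardT) auto
      also have "\<dots> = N * A * (\<Sum>k\<in>F. \<delta> k powr s)" by (simp add: sum_distrib_left mult.assoc)
      finally have "\<nu> [] / (N * A) \<le> (\<Sum>k\<in>F. \<delta> k powr s)"
        using N(1) A by (simp add: pos_divide_le_eq mult.commute)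
      then show ?thesis by (simp add: c0_def)
    qed
  qed
qed

text \<open>A single point could be covered by one arbitrarily small ball, against \<open>ball_cover_lower_bound\<close>
with \<open>s > 0\<close>.\<close>
lemma X_two_points: obtains x y where "x \<in> X" "y \<in> X" "x \<noteq> y"
proof -
  have "\<exists>x\<in>X. x \<noteq> base"
  proof (rule ccontr)
    assume "\<not> ?thesis"
    then have X: "X \<subseteq> {base}" by blast
    obtain c0 where c0: "0 < c0" "\<And>F p \<delta>. finite F \<Longrightarrow> (\<And>k::nat. k \<in> F \<Longrightarrow> 0 < \<delta> k) \<Longrightarrow>
      X \<subseteq> (\<Union>k\<in>F. ball (p k) (\<delta> k)) \<Longrightarrow> c0 \<le> (\<Sum>k\<in>F. \<delta> k powr s)"
      by (rule ball_cover_lower_bound) blast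
    define \<delta> where "\<delta> = (c0 / 2) powr (1 / s)"
    have "0 < \<delta>" using c0(1) by (simp add: \<delta>_def)
    then have "c0 \<le> (\<Sum>k\<in>{0::nat}. \<delta> powr s)"
      using X by (intro c0(2)[of "{0}" "\<lambda>_. \<delta>" "\<lambda>_. base"]) auto
    also have "\<dots> = c0 / 2" using s c0(1) by (simp add: \<delta>_def powr_powr)
    finally show False using c0(1) by simp
  qed
  then show ?thesis using that base_X by blast
qed

text \<open>The image of a ball around \<open>x\<close> that omits another point \<open>y\<close> of \<open>X\<close> contains a ball of radius
proportional to \<open>lam I\<close>, and by injectivity the image of \<open>y\<close> lies outside of it.\<close>
lemma diameter_cylinder_ge:
  obtains c1 where "0 < c1" "\<And>I. set I \<subseteq> D \<Longrightarrow> c1 * lam I \<le> diameter (word_map \<phi> I ` X)"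
proof -
  obtain x y where xy: "x \<in> X" "y \<in> X" "x \<noteq> y" by (rule X_two_points)
  define \<rho>' where "\<rho>' = min \<epsilon> (dist x y)"
  have \<rho>': "0 < \<rho>'" using \<epsilon> xy(3) by (simp add: \<rho>'_def)
  have sub: "ball x \<rho>' \<subseteq> W"
    using ball_W[of x] xy(1) X_K subset_ball[of \<rho>' \<epsilon> x] by (auto simp: \<rho>'_def)
  show ?thesis
  proof (rule that[of "\<rho>' / distortion"])
    show "0 < \<rho>' / distortion" using \<rho>' distortion_ge_1 by simp
    fix I assume I: "set I \<subseteq> D"
    have "y \<notin> ball x \<rho>'" by (simp add: \<rho>'_def)
    then have "word_map \<phi> I y \<notin> word_map \<phi> I ` ball x \<rho>'"
      using word_inj[OF I] sub xy(2) X_W by (auto dest: inj_onD)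
    then have "word_map \<phi> I y \<notin> ball (word_map \<phi> I x) (lam I / distortion * \<rho>')"
      using ball_subset_word_image[OF I sub \<rho>'] by blast
    then have "lam I / distortion * \<rho>' \<le> dist (word_map \<phi> I x) (word_map \<phi> I y)" by simp
    also have "\<dots> \<le> diameter (word_map \<phi> I ` X)"
    proof (rule diameter_bounded_bound)
      show "bounded (word_map \<phi> I ` X)"
        using word_X[OF I] by (intro bounded_subset[OF compact_imp_bounded[OF compact_X]]) blast
    qed (use xy in auto)
    finally show "\<rho>' / distortion * lam I \<le> diameter (word_map \<phi> I ` X)" by (simp add: mult.commute)
  qed
qed

lemma diameter_cylinder_le:
  obtains C where "0 < C" "\<And>I. set I \<subseteq> D \<Longrightarrow> diameter (word_map \<phi> I ` X) \<le> C * lam I"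
proof -
  obtain C where C: "0 < C" "\<And>I x y. set I \<subseteq> D \<Longrightarrow> x \<in> X \<Longrightarrow> y \<in> X \<Longrightarrow>
    dist (word_map \<phi> I x) (word_map \<phi> I y) \<le> C * lam I" by (rule cylinder_size) blast
  show ?thesis
    by (rule that[OF C(1)], rule diameter_le) (use X_nonempty C(2) in \<open>auto simp: dist_norm[symmetric]\<close>)
qed

lemma cylinder_bounded: "set I \<subseteq> D \<Longrightarrow> bounded (word_map \<phi> I ` X)"
  using word_X by (intro bounded_subset[OF compact_imp_bounded[OF compact_X]]) blast

lemma null_by_cylinders:
  fixes Y :: "nat \<Rightarrow> 'a set"
  assumes t: "0 < t"
    and cover: "\<And>N n e. 0 < e \<Longrightarrow> \<exists>L B. n \<le> L \<and> B \<subseteq> words D L \<and> Y N \<subseteq> (\<Union>I\<in>B. word_map \<phi> I ` X) \<and>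
      (\<Sum>I\<in>B. lam I powr t) \<le> e"
  shows "hausdorff_measure t (\<Union>N. Y N) = 0"
proof (rule hausdorff_measure_UN_eq_0[OF t])
  fix N and \<delta> e :: real assume \<delta>: "0 < \<delta>" and e: "0 < e"
  obtain C where C: "0 < C" "\<And>I. set I \<subseteq> D \<Longrightarrow> diameter (word_map \<phi> I ` X) \<le> C * lam I"
    by (rule diameter_cylinder_le) blast
  obtain n where n: "r ^ n < \<delta> / C" using real_arch_pow_inv[of "\<delta> / C" r] r C(1) \<delta> by auto
  obtain L B where LB: "n \<le> L" "B \<subseteq> words D L" "Y N \<subseteq> (\<Union>I\<in>B. word_map \<phi> I ` X)"
    "(\<Sum>I\<in>B. lam I powr t) \<le> e / C powr t"
    using cover[of "e / C powr t" n N] e C(1) by auto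
  have fin: "finite B" using LB(2) finite_D finite_subset finite_words by blast
  have ID: "set I \<subseteq> D" "length I = L" if "I \<in> B" for I using that LB(2) by (auto simp: words_def)
  show "\<exists>F. finite F \<and> Y N \<subseteq> \<Union>F \<and> (\<forall>U\<in>F. bounded U \<and> diameter U \<le> \<delta>) \<and> (\<Sum>U\<in>F. diameter U powr t) \<le> e"
  proof (intro exI[of _ "(\<lambda>I. word_map \<phi> I ` X) ` B"] conjI ballI)
    show "finite ((\<lambda>I. word_map \<phi> I ` X) ` B)" using fin by simp
    show "Y N \<subseteq> \<Union>((\<lambda>I. word_map \<phi> I ` X) ` B)" using LB(3) by simp
    show "bounded U" if "U \<in> (\<lambda>I. word_map \<phi> I ` X) ` B" for U
      using that ID(1) cylinder_bounded by blast
    show "diameter U \<le> \<delta>" if U: "U \<in> (\<lambda>I. word_map \<phi> I ` X) ` B" for U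
    proof -
      obtain I where I: "I \<in> B" "U = word_map \<phi> I ` X" using U by blast
      have "diameter U \<le> C * lam I" using C(2)[OF ID(1)[OF I(1)]] I(2) by simp
      also have "\<dots> \<le> C * r ^ L"
        using lam_bounds(2)[OF ID(1)[OF I(1)]] ID(2)[OF I(1)] C(1) by (intro mult_left_mono) auto
      also have "\<dots> \<le> C * r ^ n" using C(1) r LB(1) by (intro mult_left_mono power_decreasing) auto
      also have "\<dots> \<le> \<delta>" using n C(1) by (simp add: field_simps)
      finally show ?thesis .
    qed
    have "(\<Sum>U\<in>(\<lambda>I. word_map \<phi> I ` X) ` B. diameter U powr t)
        \<le> sum ((\<lambda>U. diameter U powr t) \<circ> (\<lambda>I. word_map \<phi> I ` X)) B"
      using fin by (intro sum_image_le) auto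
    also have "\<dots> \<le> (\<Sum>I\<in>B. (C * lam I) powr t)"
      using C(2) ID(1) t cylinder_bounded
      by (intro sum_mono) (auto intro!: powr_mono2 diameter_ge_0)
    also have "\<dots> = C powr t * (\<Sum>I\<in>B. lam I powr t)"
      unfolding sum_distrib_left
      using C(1) lam_pos ID(1) by (intro sum.cong refl) (simp add: powr_mult less_imp_le)
    also have "\<dots> \<le> C powr t * (e / C powr t)" using LB(4) by (intro mult_left_mono) auto
    also have "\<dots> = e" using C(1) by simp
    finally show "(\<Sum>U\<in>(\<lambda>I. word_map \<phi> I ` X) ` B. diameter U powr t) \<le> e" .
  qed
qed

lemma sum_lam_le: "(\<Sum>I\<in>words D n. lam I powr s) \<le> A * \<nu> []"
proof -
  have "(\<Sum>I\<in>words D n. lam I powr s) \<le> (\<Sum>I\<in>words D n. A * \<nu> ([] @ I))"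
    by (intro sum_mono) (auto simp: words_def intro: lam_le_nu)
  also have "\<dots> = A * \<nu> []"
    using nu.sum_extensions[of "[]" n] by (simp add: sum_distrib_left[symmetric])
  finally show ?thesis .
qed

text \<open>For \<open>t > s\<close> the covers by all cylinders of length \<open>L\<close> have \<open>t\<close>-sums tending to \<open>0\<close>. For \<open>t < s\<close> the
sets of a cover with diameters at most \<open>1\<close> have \<open>t\<close>-sum no less than their \<open>s\<close>-sum, which is
bounded below.\<close>
theorem hausdorff_dim_attractor: "hausdorff_dim X = s"
proof -
  obtain c0 where c0: "0 < c0" "\<And>F p \<delta>. finite F \<Longrightarrow> (\<And>k::nat. k \<in> F \<Longrightarrow> 0 < \<delta> k) \<Longrightarrow>
      X \<subseteq> (\<Union>k\<in>F. ball (p k) (\<delta> k)) \<Longrightarrow> c0 \<le> (\<Sum>k\<in>F. \<delta> k powr s)"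
    by (rule ball_cover_lower_bound) blast
  have above: "hausdorff_measure t X = 0" if t: "s < t" for t
  proof -
    have "hausdorff_measure t (\<Union>N::nat. X) = 0"
    proof (rule null_by_cylinders)
      show "0 < t" using s t by simp
      fix n and e :: real assume e: "0 < e"
      define q where "q = r powr (t - s)"
      have q: "0 < q" "q < 1" unfolding q_def using r t powr_less_mono2[of "t - s" r 1] by auto
      have A\<nu>: "0 < A * \<nu> []" using A nu_Nil_pos by simp
      obtain k where k: "q ^ k < e / (A * \<nu> [])" using real_arch_pow_inv[of "e / (A * \<nu> [])" q] q e A\<nu> by auto
      define L where "L = n + k"
      have "(\<Sum>I\<in>words D L. lam I powr t) \<le> (\<Sum>I\<in>words D L. q ^ L * lam I powr s)"
      proof (rule sum_mono)
        fix I assume "I \<in> words D L"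
        then have I: "set I \<subseteq> D" "length I = L" by (auto simp: words_def)
        have "lam I powr t = lam I powr (t - s) * lam I powr s" by (simp add: powr_add[symmetric])
        also have "\<dots> \<le> (r ^ L) powr (t - s) * lam I powr s"
          using lam_bounds(2)[OF I(1)] lam_pos[OF I(1)] I(2) t by (intro mult_right_mono powr_mono2) auto
        also have "(r ^ L) powr (t - s) = q ^ L"
          using r by (simp add: q_def powr_realpow[symmetric] powr_powr mult.commute)
        finally show "lam I powr t \<le> q ^ L * lam I powr s" .
      qed
      also have "\<dots> \<le> q ^ L * (A * \<nu> [])"
        using sum_lam_le[of L] q by (simp add: sum_distrib_left[symmetric])
      also have "\<dots> \<le> q ^ k * (A * \<nu> [])"
        using A\<nu> q by (intro mult_right_mono power_decreasing) (auto simp: L_def)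
      also have "\<dots> \<le> e" using k A\<nu> by (simp add: pos_less_divide_eq)
      finally have "(\<Sum>I\<in>words D L. lam I powr t) \<le> e" .
      moreover have "X \<subseteq> (\<Union>I\<in>words D L. word_map \<phi> I ` X)" using X_words by blast
      ultimately show "\<exists>L B. n \<le> L \<and> B \<subseteq> words D L \<and> X \<subseteq> (\<Union>I\<in>B. word_map \<phi> I ` X) \<and>
          (\<Sum>I\<in>B. lam I powr t) \<le> e"
        by (intro exI[of _ L] exI[of _ "words D L"]) (simp add: L_def)
    qed
    then show ?thesis by simp
  qed
  have below: "s \<le> t" if t: "0 \<le> t" "hausdorff_measure t X = 0" for t
  proof (rule ccontr)
    assume "\<not> s \<le> t"
    have "hausdorff_premeasure t 1 X \<le> hausdorff_measure t X"
      unfolding hausdorff_measure_def by (rule SUP_upper) simp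
    then have "hausdorff_premeasure t 1 X < ennreal c0" using t(2) c0(1) by simp
    then obtain V where V: "X \<subseteq> (\<Union>k. V k)" "\<And>k. bounded (V k)" "\<And>k. diameter (V k) \<le> 1"
      "(\<Sum>k. if V k = {} then 0 else ennreal (rpow (diameter (V k)) t)) < ennreal c0"
      unfolding hausdorff_premeasure_def INF_less_iff by blast
    have "ennreal c0 \<le> (\<Sum>k. if V k = {} then 0 else ennreal (diameter (V k) powr s))"
      by (rule compact_cover_sum_lower_bound[OF compact_X s c0(1) c0(2) V(1,2)])
    also have "\<dots> \<le> (\<Sum>k. if V k = {} then 0 else ennreal (rpow (diameter (V k)) t))"
    proof (rule suminf_le)
      fix k
      have "diameter (V k) powr s \<le> rpow (diameter (V k)) t"
      proof (cases "t = 0")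
        case True
        have "diameter (V k) powr s \<le> 1 powr s"
          using V(3)[of k] diameter_ge_0[OF V(2)] s by (intro powr_mono2) auto
        then show ?thesis by (simp add: rpow_def True)
      next
        case False
        then show ?thesis
          using V(3)[of k] diameter_ge_0[OF V(2)] \<open>\<not> s \<le> t\<close> t(1)
          by (simp add: rpow_def powr_mono')
      qed
      then show "(if V k = {} then 0 else ennreal (diameter (V k) powr s))
          \<le> (if V k = {} then 0 else ennreal (rpow (diameter (V k)) t))"
        by (simp add: ennreal_leI)
    qed auto
    finally show False using V(4) by simp
  qed
  show ?thesis unfolding hausdorff_dim_def
  proof (rule cInf_eq_non_empty)
    have "s + 1 \<in> {t. 0 \<le> t \<and> hausdorff_measure t X = 0}" using above[of "s + 1"] s by simp
    then show "{t. 0 \<le> t \<and> hausdorff_measure t X = 0} \<noteq> {}" by blast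
    show "s \<le> t" if "t \<in> {t. 0 \<le> t \<and> hausdorff_measure t X = 0}" for t using that below by simp
    show "y \<le> s" if y: "\<And>t. t \<in> {t. 0 \<le> t \<and> hausdorff_measure t X = 0} \<Longrightarrow> y \<le> t" for y
    proof (rule dense_ge)
      fix t assume "s < t"
      then show "y \<le> t" using y[of t] above[of t] s by simp
    qed
  qed
qed

end


context conformal_gibbs
begin

section \<open>Recurrence to shrinking balls\<close>

text \<open>The prefix of a coding of \<open>z\<close> at which the scale reaches \<open>\<delta>\<close>; for \<open>\<delta> \<ge> 1\<close> it is empty, and then
there is no lower bound in terms of \<open>\<delta>\<close>.\<close>
lemma target_words:
  assumes z: "z \<in> X" and \<delta>: "0 < \<delta>"
  obtains t where "set t \<subseteq> D" "z \<in> word_map \<phi> t ` X" "lam t \<le> \<delta>"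
    "t \<noteq> [] \<Longrightarrow> m / distortion * \<delta> \<le> lam t"
proof -
  obtain n where n: "r ^ n < \<delta>" using real_arch_pow_inv[OF \<delta> r(2)] by blast
  obtain I where I: "I \<in> words D n" "z \<in> word_map \<phi> I ` X" using X_words[OF z] by blast
  have ID: "set I \<subseteq> D" "length I = n" using I(1) by (auto simp: words_def)
  have "lam I \<le> \<delta>" using lam_bounds(2)[OF ID(1)] ID(2) n by simp
  from stopping_prefix[OF ID(1) this] obtain j where
    "lam (take j I) \<le> \<delta>" "take j I \<noteq> [] \<Longrightarrow> m / distortion * \<delta> \<le> lam (take j I)" by blast
  moreover have "set (take j I) \<subseteq> D" using ID(1) by (auto dest: in_set_takeD)
  moreover have "z \<in> word_map \<phi> (take j I) ` X" by (rule word_map_take[OF ID(1) I(2)])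
  ultimately show ?thesis using that by blast
qed

text \<open>The sums of \<open>lam I powr s\<close> over words of one length are bounded, so the inner sum is at most a
constant times \<open>\<theta> (Suc n) powr s\<close>.\<close>
lemma divergence_radii:
  assumes \<theta>: "\<And>n. 0 \<le> \<theta> n"
    and diverge: "(\<Sum>n. \<Sum>I\<in>words D (Suc n).
      ennreal (rpow (diameter (word_map \<phi> I ` X) * \<theta> (Suc n)) s)) = \<infinity>"
  shows "\<not> summable (\<lambda>n. \<theta> n powr s)"
proof
  assume summ: "summable (\<lambda>n. \<theta> n powr s)"
  obtain C where C: "0 < C" "\<And>I. set I \<subseteq> D \<Longrightarrow> diameter (word_map \<phi> I ` X) \<le> C * lam I"
    by (rule diameter_cylinder_le) blast
  define M where "M = C powr s * (A * \<nu> [])"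
  have M: "0 \<le> M" using A nu_Nil_pos by (simp add: M_def)
  have le: "(\<Sum>I\<in>words D (Suc n). ennreal (rpow (diameter (word_map \<phi> I ` X) * \<theta> (Suc n)) s))
      \<le> ennreal (M * \<theta> (Suc n) powr s)" for n
  proof -
    have "(\<Sum>I\<in>words D (Suc n). (diameter (word_map \<phi> I ` X) * \<theta> (Suc n)) powr s)
        \<le> (\<Sum>I\<in>words D (Suc n). C powr s * \<theta> (Suc n) powr s * lam I powr s)"
    proof (rule sum_mono)
      fix I assume "I \<in> words D (Suc n)"
      then have I: "set I \<subseteq> D" by (simp add: words_def)
      have "(diameter (word_map \<phi> I ` X) * \<theta> (Suc n)) powr s \<le> ((C * lam I) * \<theta> (Suc n)) powr s"
        using C(2)[OF I] \<theta> s diameter_ge_0[OF cylinder_bounded[OF I]]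
        by (intro powr_mono2 mult_right_mono) auto
      also have "\<dots> = C powr s * \<theta> (Suc n) powr s * lam I powr s"
        using C(1) lam_pos[OF I] \<theta> by (simp add: powr_mult less_imp_le mult_ac)
      finally show "(diameter (word_map \<phi> I ` X) * \<theta> (Suc n)) powr s \<le> \<dots>" .
    qed
    also have "\<dots> = C powr s * \<theta> (Suc n) powr s * (\<Sum>I\<in>words D (Suc n). lam I powr s)"
      by (simp add: sum_distrib_left)
    also have "\<dots> \<le> C powr s * \<theta> (Suc n) powr s * (A * \<nu> [])"
      by (intro mult_left_mono sum_lam_le) auto
    also have "\<dots> = M * \<theta> (Suc n) powr s" by (simp add: M_def mult_ac)
    finally have "ennreal (\<Sum>I\<in>words D (Suc n). (diameter (word_map \<phi> I ` X) * \<theta> (Suc n)) powr s)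
        \<le> ennreal (M * \<theta> (Suc n) powr s)" by (rule ennreal_leI)
    then show ?thesis using s by (simp add: rpow_def)
  qed
  have summ': "summable (\<lambda>n. M * \<theta> (Suc n) powr s)"
    using summ summable_Suc_iff[of "\<lambda>n. \<theta> n powr s"] by (intro summable_mult) simp
  have "(\<Sum>n. \<Sum>I\<in>words D (Suc n). ennreal (rpow (diameter (word_map \<phi> I ` X) * \<theta> (Suc n)) s))
      \<le> (\<Sum>n. ennreal (M * \<theta> (Suc n) powr s))" by (intro suminf_le le) auto
  also have "\<dots> = ennreal (\<Sum>n. M * \<theta> (Suc n) powr s)"
    using M summ' by (intro suminf_ennreal_eq summable_sums) auto
  finally show False using diverge by (simp add: top_unique)
qed

text \<open>The targets are words \<open>t n\<close> of scale about \<open>g * \<theta> n\<close>, where \<open>g\<close> is chosen such that the cylinder of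
\<open>I @ t n\<close>, which contains the centre \<open>word_map \<phi> I z\<close>, fits in the ball around it. Positions with
\<open>\<theta> n = 0\<close> have no target.\<close>
theorem limsup_set_full_measure:
  assumes z: "z \<in> X" and \<theta>: "\<And>n. 0 \<le> \<theta> n"
    and diverge: "(\<Sum>n. \<Sum>I\<in>words D (Suc n).
      ennreal (rpow (diameter (word_map \<phi> I ` X) * \<theta> (Suc n)) s)) = \<infinity>"
  shows "hausdorff_measure s (X - limsup_set D \<phi> X \<theta> z) = 0"
proof -
  obtain C where C: "0 < C" "\<And>I. set I \<subseteq> D \<Longrightarrow> diameter (word_map \<phi> I ` X) \<le> C * lam I"
    by (rule diameter_cylinder_le) blast
  obtain c1 where c1: "0 < c1" "\<And>I. set I \<subseteq> D \<Longrightarrow> c1 * lam I \<le> diameter (word_map \<phi> I ` X)"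
    by (rule diameter_cylinder_ge) blast
  define g where "g = c1 / (C * distortion)"
  define S where "S = {n. 0 < \<theta> n}"
  have g: "0 < g" using c1(1) C(1) distortion_ge_1 by (simp add: g_def)
  have "\<exists>t. n \<in> S \<longrightarrow> set t \<subseteq> D \<and> z \<in> word_map \<phi> t ` X \<and> lam t \<le> g * \<theta> n \<and>
      (t \<noteq> [] \<longrightarrow> m / distortion * (g * \<theta> n) \<le> lam t)" for n
  proof (cases "n \<in> S")
    case True
    then have "0 < g * \<theta> n" using g by (simp add: S_def)
    then show ?thesis by (rule target_words[OF z]) blast
  qed simp
  then obtain t where t: "\<And>n. n \<in> S \<Longrightarrow> set (t n) \<subseteq> D" "\<And>n. n \<in> S \<Longrightarrow> z \<in> word_map \<phi> (t n) ` X"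
    "\<And>n. n \<in> S \<Longrightarrow> lam (t n) \<le> g * \<theta> n"
    "\<And>n. n \<in> S \<Longrightarrow> t n \<noteq> [] \<Longrightarrow> m / distortion * (g * \<theta> n) \<le> lam (t n)"
    by metis
  have not_summable: "\<not> summable (\<lambda>n. if n \<in> S then \<nu> (t n) else 0)"
  proof
    define a where "a n = (if n \<in> S then \<nu> (t n) else 0)" for n
    assume "summable (\<lambda>n. if n \<in> S then \<nu> (t n) else 0)"
    then have a: "summable a" by (simp add: a_def[abs_def])
    define G where "G = m / distortion * g"
    have G: "0 < G" using m distortion_ge_1 g by (simp add: G_def)
    \<comment> \<open>Eventually the target weight is below \<open>\<nu> []\<close>, so the target is not the empty word and its scale is
comparable to \<open>\<theta> n\<close>.\<close>
    have "\<forall>\<^sub>F n in sequentially. a n < \<nu> []"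
      using summable_LIMSEQ_zero[OF a] nu_Nil_pos by (rule order_tendstoD)
    then have "\<forall>\<^sub>F n in sequentially. norm (\<theta> n powr s) \<le> A / G powr s * a n"
    proof eventually_elim
      fix n assume an: "a n < \<nu> []"
      show "norm (\<theta> n powr s) \<le> A / G powr s * a n"
      proof (cases "n \<in> S")
        case False
        then have "\<theta> n = 0" using \<theta>[of n] by (simp add: S_def)
        then show ?thesis using False by (simp add: a_def)
      next
        case True
        then have "t n \<noteq> []" using an by (auto simp: a_def)
        then have "G * \<theta> n \<le> lam (t n)" using t(4)[OF True] by (simp add: G_def mult_ac)
        then have "(G * \<theta> n) powr s \<le> lam (t n) powr s"
          using G \<theta>[of n] s by (intro powr_mono2) auto
        also have "\<dots> \<le> A * a n" using lam_le_nu[OF t(1)[OF True]] True by (simp add: a_def)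
        finally have "G powr s * \<theta> n powr s \<le> A * a n" using G \<theta>[of n] by (simp add: powr_mult)
        then show ?thesis using G by (simp add: field_simps)
      qed
    qed
    then have "summable (\<lambda>n. \<theta> n powr s)"
      using summable_mult[OF a] by (rule summable_comparison_test_ev)
    then show False using divergence_radii[OF \<theta> diverge] by blast
  qed
  define Y where "Y N = {x \<in> X. \<forall>n\<ge>Suc N. \<forall>I\<in>words D n.
      x \<notin> cball (word_map \<phi> I z) (diameter (word_map \<phi> I ` X) * \<theta> n)}" for N
  have "hausdorff_measure s (\<Union>N. Y N) = 0"
  proof (rule null_by_cylinders[OF s])
    fix N n and e :: real assume e: "0 < e"
    obtain L B where LB: "n \<le> L" "B \<subseteq> words D L" "sum \<nu> B < e / A"
      "\<And>I. I \<in> words D L - B \<Longrightarrow> \<exists>n\<in>S. Suc N \<le> n \<and> n + length (t n) \<le> L \<and> occurs_at (t n) n I"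
      using nu.shrinking_targets[OF t(1) not_summable, where e = "e / A" and m = n and N = "Suc N"] e A by auto
    have "Y N \<subseteq> (\<Union>I\<in>B. word_map \<phi> I ` X)"
    proof
      fix x assume x: "x \<in> Y N"
      then obtain V where V: "V \<in> words D L" "x \<in> word_map \<phi> V ` X"
        using X_words[of x L] by (auto simp: Y_def)
      show "x \<in> (\<Union>I\<in>B. word_map \<phi> I ` X)"
      proof (rule ccontr)
        assume "\<not> ?thesis"
        then obtain k where k: "k \<in> S" "Suc N \<le> k" "k + length (t k) \<le> L" "occurs_at (t k) k V"
          using LB(4)[of V] V by blast
        define I where "I = take k V"
        have VD: "set V \<subseteq> D" "length V = L" using V(1) by (auto simp: words_def)
        have I: "I \<in> words D k" using VD k(3) by (auto simp: I_def words_def dest: in_set_takeD)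
        have ID: "set I \<subseteq> D" using I by (simp add: words_def)
        have It: "take (k + length (t k)) V = I @ t k"
          using k(4) by (simp add: I_def occurs_at_def take_add)
        have ItD: "set (I @ t k) \<subseteq> D" using ID t(1)[OF k(1)] by simp
        have "x \<in> word_map \<phi> (I @ t k) ` X"
          unfolding It[symmetric] by (rule word_map_take[OF VD(1) V(2)])
        moreover have "word_map \<phi> I z \<in> word_map \<phi> (I @ t k) ` X"
          using t(2)[OF k(1)] by (auto simp: word_map_append)
        ultimately have "dist (word_map \<phi> I z) x \<le> diameter (word_map \<phi> (I @ t k) ` X)"
          by (intro diameter_bounded_bound cylinder_bounded ItD)
        also have "\<dots> \<le> C * lam (I @ t k)" by (rule C(2)[OF ItD])
        also have "\<dots> \<le> C * (distortion * lam I * lam (t k))"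
          using C(1) lam.w_append_le[OF ID t(1)[OF k(1)]] by (intro mult_left_mono) auto
        also have "\<dots> \<le> C * (distortion * lam I * (g * \<theta> k))"
          using C(1) t(3)[OF k(1)] lam_pos[OF ID] distortion_ge_1 by (intro mult_left_mono) auto
        also have "\<dots> = c1 * lam I * \<theta> k"
          using C(1) distortion_ge_1 by (simp add: g_def)
        also have "\<dots> \<le> diameter (word_map \<phi> I ` X) * \<theta> k"
          using c1(2)[OF ID] \<theta> by (intro mult_right_mono) auto
        finally show False using x I k(2) by (auto simp: Y_def)
      qed
    qed
    moreover have "(\<Sum>I\<in>B. lam I powr s) \<le> e"
    proof -
      have "(\<Sum>I\<in>B. lam I powr s) \<le> (\<Sum>I\<in>B. A * \<nu> I)"
        using LB(2) by (intro sum_mono lam_le_nu) (auto simp: words_def)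
      also have "\<dots> = A * sum \<nu> B" by (simp add: sum_distrib_left)
      also have "\<dots> \<le> e" using LB(3) A by (simp add: field_simps)
      finally show ?thesis .
    qed
    ultimately show "\<exists>L B. n \<le> L \<and> B \<subseteq> words D L \<and> Y N \<subseteq> (\<Union>I\<in>B. word_map \<phi> I ` X) \<and>
        (\<Sum>I\<in>B. lam I powr s) \<le> e"
      using LB(1,2) by blast
  qed
  moreover have "X - limsup_set D \<phi> X \<theta> z \<subseteq> (\<Union>N. Y N)"
  proof
    fix x assume x: "x \<in> X - limsup_set D \<phi> X \<theta> z"
    define M where "M = {I \<in> (\<Union>n\<in>{1..}. words D n).
        x \<in> cball (word_map \<phi> I z) (diameter (word_map \<phi> I ` X) * \<theta> (length I))}"
    have fin: "finite M" using x by (simp add: limsup_set_def M_def)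
    define N where "N = (\<Sum>I\<in>M. length I)"
    have N: "length I \<le> N" if "I \<in> M" for I
      unfolding N_def using that fin by (intro member_le_sum) auto
    have "x \<notin> cball (word_map \<phi> I z) (diameter (word_map \<phi> I ` X) * \<theta> n)"
      if "Suc N \<le> n" "I \<in> words D n" for n I
    proof
      assume "x \<in> cball (word_map \<phi> I z) (diameter (word_map \<phi> I ` X) * \<theta> n)"
      moreover have len: "length I = n" using that(2) by (simp add: words_def)
      ultimately have "I \<in> M" using that by (auto simp: M_def)
      then show False using N[of I] len that(1) by simp
    qed
    then show "x \<in> (\<Union>N. Y N)" using x by (auto simp: Y_def intro!: exI[of _ N])
  qed
  ultimately show ?thesis using hausdorff_measure_mono by (metis le_zero_eq)
qed

end

section \<open>From a conformal iterated function system to the limsup set\<close>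

text \<open>The attractor of a single contraction is a point, which is the centre of all the balls. Here the
infinitely many words are the powers of the only letter.\<close>
lemma (in conformal_system) limsup_set_single_map:
  assumes D: "D = {i}" and z: "z \<in> X"
  shows "X \<subseteq> limsup_set D \<phi> X \<theta> z"
proof -
  have bX: "bounded X" using compact_X by (rule compact_imp_bounded)
  have "diameter X \<le> r * diameter X"
  proof (rule diameter_le)
    fix x y assume "x \<in> X" "y \<in> X"
    then have "x \<in> (\<Union>i\<in>D. \<phi> i ` X)" "y \<in> (\<Union>i\<in>D. \<phi> i ` X)" using X_eq by blast+
    then obtain x' y' where xy: "x' \<in> X" "y' \<in> X" "x = \<phi> i x'" "y = \<phi> i y'"
      unfolding D by blast
    have "dist x y \<le> r * dist x' y'" unfolding xy using xy X_W D by (intro contract) auto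
    also have "\<dots> \<le> r * diameter X"
      using r xy diameter_bounded_bound[OF bX] by (intro mult_left_mono) auto
    finally show "norm (x - y) \<le> r * diameter X" by (simp add: dist_norm)
  qed (use X_nonempty in simp)
  then have "(1 - r) * diameter X \<le> 0" by (simp add: algebra_simps)
  then have "diameter X \<le> 0" using r by (simp add: mult_le_0_iff)
  then have eq: "x = y" if "x \<in> X" "y \<in> X" for x y
  proof -
    have "dist x y \<le> 0"
      using diameter_bounded_bound[OF bX that] \<open>diameter X \<le> 0\<close> by linarith
    then show ?thesis by simp
  qed
  show ?thesis
  proof
    fix x assume x: "x \<in> X"
    have in_ball: "x \<in> cball (word_map \<phi> I z) (diameter (word_map \<phi> I ` X) * \<theta> (length I))"
      if "set I \<subseteq> D" for I
    proof -
      have "word_map \<phi> I ` X = {x}" using word_X[OF that] eq x X_nonempty by blast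
      moreover have "word_map \<phi> I z = x" using word_X[OF that z] eq x by blast
      ultimately show ?thesis by simp
    qed
    have in_words: "replicate (Suc n) i \<in> (\<Union>n\<in>{1..}. words D n)" for n
      using D by (intro UN_I[of "Suc n"]) (auto simp: words_def)
    have "range (\<lambda>n. replicate (Suc n) i) \<subseteq> {I \<in> (\<Union>n\<in>{1..}. words D n).
        x \<in> cball (word_map \<phi> I z) (diameter (word_map \<phi> I ` X) * \<theta> (length I))}"
    proof (rule image_subsetI, rule CollectI, rule conjI[OF in_words in_ball])
      show "set (replicate (Suc n) i) \<subseteq> D" for n using D by (simp only: set_replicate_Suc)
    qed
    moreover have "inj (\<lambda>n. replicate (Suc n) i)"
      by (rule injI) (metis length_replicate nat.inject)
    then have "infinite (range (\<lambda>n. replicate (Suc n) i))" by (rule range_inj_infinite)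
    ultimately have "infinite {I \<in> (\<Union>n\<in>{1..}. words D n).
        x \<in> cball (word_map \<phi> I z) (diameter (word_map \<phi> I ` X) * \<theta> (length I))}"
      by (rule infinite_super)
    then show "x \<in> limsup_set D \<phi> X \<theta> z" using x by (simp add: limsup_set_def)
  qed
qed

text \<open>Uniform constants exist because \<open>D\<close> is finite, and \<open>W\<close> is a neighbourhood of the compact set \<open>K\<close>
inside \<open>V\<close>. The open set of the open set condition is intersected with \<open>W\<close>; it meets \<open>W\<close> because
the orbit of any of its points under one of the maps approaches \<open>K\<close>.\<close>
lemma conformal_system_exists:
  fixes K V X :: "'a::euclidean_space set"
  assumes conf: "conformal_ifs K V D \<phi>" and osc: "open_set_condition V D \<phi>" and att: "attractor K D \<phi> X"
  obtains W U \<phi>' \<epsilon> r m c \<alpha> where "conformal_system K W X U D \<phi> \<phi>' \<epsilon> r m c \<alpha>"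
proof -
  have X: "X \<subseteq> K" "X \<noteq> {}" "compact X" "X = (\<Union>i\<in>D. \<phi> i ` X)"
    using att by (auto simp: attractor_def)
  have K: "finite D" "compact K" "open V" "K \<subseteq> V" "\<And>i. i \<in> D \<Longrightarrow> \<phi> i ` K \<subseteq> K"
    using conf by (auto simp: conformal_ifs_def ifs_def)
  obtain \<phi>' \<alpha> c where \<phi>': "\<And>i. i \<in> D \<Longrightarrow> inj_on (\<phi> i) V" "\<And>i. i \<in> D \<Longrightarrow> contraction_on V (\<phi> i)"
    "\<And>i. i \<in> D \<Longrightarrow> conformal_on V (\<phi> i) (\<phi>' i)"
    "\<And>i. i \<in> D \<Longrightarrow> 0 < (INF x\<in>V. ereal (norm (\<phi>' i x)))"
    "\<And>i. i \<in> D \<Longrightarrow> (SUP x\<in>V. ereal (norm (\<phi>' i x))) < 1"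
    and \<alpha>: "0 < \<alpha>" "0 < c" "\<And>i x y. i \<in> D \<Longrightarrow> x \<in> V \<Longrightarrow> y \<in> V \<Longrightarrow>
              \<bar>norm (\<phi>' i x) - norm (\<phi>' i y)\<bar> \<le> c * norm (x - y) powr \<alpha>"
    using conf unfolding conformal_ifs_def by blast
  have "\<exists>q. q < 1 \<and> (\<forall>x\<in>V. \<forall>y\<in>V. dist (\<phi> i x) (\<phi> i y) \<le> q * dist x y)" if "i \<in> D" for i
    using \<phi>'(2)[OF that] unfolding contraction_on_def lipschitz_on_def by blast
  then obtain q1 where q1: "\<And>i. i \<in> D \<Longrightarrow> q1 i < 1"
    "\<And>i x y. i \<in> D \<Longrightarrow> x \<in> V \<Longrightarrow> y \<in> V \<Longrightarrow> dist (\<phi> i x) (\<phi> i y) \<le> q1 i * dist x y"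
    by metis
  have "\<exists>q. q < 1 \<and> (\<forall>x\<in>V. norm (\<phi>' i x) \<le> q)" if i: "i \<in> D" for i
  proof -
    obtain q where q: "(SUP x\<in>V. ereal (norm (\<phi>' i x))) < ereal q" "ereal q < 1"
      using ereal_dense2[OF \<phi>'(5)[OF i]] by blast
    have "ereal (norm (\<phi>' i x)) \<le> ereal q" if "x \<in> V" for x
      using q(1) that by (meson SUP_upper less_imp_le order_trans)
    then show ?thesis using q(2) by (intro exI[of _ q]) auto
  qed
  then obtain q2 where q2: "\<And>i. i \<in> D \<Longrightarrow> q2 i < 1" "\<And>i x. i \<in> D \<Longrightarrow> x \<in> V \<Longrightarrow> norm (\<phi>' i x) \<le> q2 i"
    by metis
  have "\<exists>q>0. \<forall>x\<in>V. q \<le> norm (\<phi>' i x)" if i: "i \<in> D" for i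
  proof -
    obtain q where q: "0 < ereal q" "ereal q < (INF x\<in>V. ereal (norm (\<phi>' i x)))"
      using ereal_dense2[OF \<phi>'(4)[OF i]] by blast
    have "ereal q \<le> ereal (norm (\<phi>' i x))" if "x \<in> V" for x
      using q(2) that by (meson INF_lower less_imp_le order_trans)
    then show ?thesis using q(1) by (intro exI[of _ q]) auto
  qed
  then obtain q3 where q3: "\<And>i. i \<in> D \<Longrightarrow> 0 < q3 i" "\<And>i x. i \<in> D \<Longrightarrow> x \<in> V \<Longrightarrow> q3 i \<le> norm (\<phi>' i x)"
    by metis
  define r where "r = Max (insert (1 / 2) (q1 ` D \<union> q2 ` D))"
  define m where "m = Min (insert 1 (q3 ` D))"
  have r: "0 < r" "r < 1"
  proof -
    have "1 / 2 \<le> r" unfolding r_def using K(1) by (intro Max_ge) auto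
    then show "0 < r" by simp
    show "r < 1" unfolding r_def using K(1) q1(1) q2(1) by (subst Max_less_iff) auto
  qed
  have qr: "q1 i \<le> r" "q2 i \<le> r" if "i \<in> D" for i
    unfolding r_def using K(1) that by (auto intro!: Max_ge)
  have m: "0 < m" unfolding m_def using K(1) q3(1) by (subst Min_gr_iff) auto
  have mq: "m \<le> q3 i" if "i \<in> D" for i unfolding m_def using K(1) that by (auto intro!: Min_le)
  have contract: "dist (\<phi> i x) (\<phi> i y) \<le> r * dist x y" if "i \<in> D" "x \<in> V" "y \<in> V" for i x y
    using q1(2)[OF that] mult_right_mono[OF qr(1)[OF that(1)], of "dist x y"] by simp
  obtain \<epsilon> where \<epsilon>: "0 < \<epsilon>" "(\<Union>x\<in>K. ball x \<epsilon>) \<subseteq> V"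
    using compact_subset_open_imp_ball_epsilon_subset[OF K(2,3,4)] by blast
  define W where "W = (\<Union>x\<in>K. ball x \<epsilon>)"
  have WV: "W \<subseteq> V" using \<epsilon>(2) by (simp add: W_def)
  have W_maps: "\<phi> i ` W \<subseteq> W" if i: "i \<in> D" for i
  proof clarify
    fix x assume x: "x \<in> W"
    then obtain k where k: "k \<in> K" "dist k x < \<epsilon>" by (auto simp: W_def)
    have "dist (\<phi> i k) (\<phi> i x) \<le> r * dist k x" using i x k(1) K(4) WV by (intro contract) auto
    also have "\<dots> \<le> 1 * dist k x" using r by (intro mult_right_mono) auto
    finally have "\<phi> i x \<in> ball (\<phi> i k) \<epsilon>" using k(2) by simp
    moreover have "\<phi> i k \<in> K" using K(5)[OF i] k(1) by blast
    ultimately show "\<phi> i x \<in> W" unfolding W_def by blast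
  qed
  obtain O' where "open O' \<and> O' \<noteq> {} \<and> O' \<subseteq> V \<and> (\<forall>i\<in>D. \<phi> i ` O' \<subseteq> O') \<and>
      (\<forall>i\<in>D. \<forall>j\<in>D. i \<noteq> j \<longrightarrow> \<phi> i ` O' \<inter> \<phi> j ` O' = {})"
    using osc unfolding open_set_condition_def ..
  then have O': "open O'" "O' \<noteq> {}" "O' \<subseteq> V" "\<And>i. i \<in> D \<Longrightarrow> \<phi> i ` O' \<subseteq> O'"
    "\<And>i j. i \<in> D \<Longrightarrow> j \<in> D \<Longrightarrow> i \<noteq> j \<Longrightarrow> \<phi> i ` O' \<inter> \<phi> j ` O' = {}"
    by simp_all
  define U where "U = O' \<inter> W"
  have "D \<noteq> {}" using X(2,4) by blast
  then obtain i where i: "i \<in> D" by blast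
  have "U \<noteq> {}"
  proof -
    obtain x where x: "x \<in> X" using X(2) by blast
    obtain u where u: "u \<in> O'" using O'(2) by blast
    have orbit: "(\<phi> i ^^ n) x \<in> K \<and> (\<phi> i ^^ n) u \<in> O' \<and>
        dist ((\<phi> i ^^ n) x) ((\<phi> i ^^ n) u) \<le> r ^ n * dist x u" for n
    proof (induction n)
      case 0
      then show ?case using x u X(1) by auto
    next
      case (Suc n)
      let ?x = "(\<phi> i ^^ n) x" and ?u = "(\<phi> i ^^ n) u"
      have "dist (\<phi> i ?x) (\<phi> i ?u) \<le> r * dist ?x ?u"
        using Suc K(4) O'(3) by (intro contract[OF i]) auto
      also have "\<dots> \<le> r * (r ^ n * dist x u)" using Suc r by (intro mult_left_mono) auto
      finally show ?case using Suc K(5)[OF i] O'(4)[OF i] by auto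
    qed
    obtain n where n: "r ^ n < \<epsilon> / (dist x u + 1)"
      using real_arch_pow_inv[of "\<epsilon> / (dist x u + 1)" r] r \<epsilon>(1) by (auto simp: add_nonneg_pos)
    have "r ^ n * dist x u \<le> r ^ n * (dist x u + 1)" using r by (intro mult_left_mono) auto
    also have "\<dots> < \<epsilon>" using n by (simp add: pos_less_divide_eq add_nonneg_pos)
    finally have "(\<phi> i ^^ n) u \<in> ball ((\<phi> i ^^ n) x) \<epsilon>" using orbit[of n] by simp
    then have "(\<phi> i ^^ n) u \<in> U" using orbit[of n] unfolding U_def W_def by blast
    then show ?thesis by blast
  qed
  have "conformal_system K W X U D \<phi> \<phi>' \<epsilon> r m c \<alpha>"
  proof
    show "finite D" "D \<noteq> {}" "compact K" "W = (\<Union>x\<in>K. ball x \<epsilon>)" "0 < \<epsilon>" "0 < m" "0 < r" "r < 1"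
      "0 < c" "0 < \<alpha>" "X \<subseteq> K" "X \<noteq> {}" "compact X" "X = (\<Union>i\<in>D. \<phi> i ` X)" "U \<noteq> {}" "U \<subseteq> W"
      by (fact K(1) \<open>D \<noteq> {}\<close> K(2) W_def \<epsilon>(1) m r \<alpha>(1,2) X \<open>U \<noteq> {}\<close>)+ (simp add: U_def)
    show "open U" unfolding U_def W_def using O'(1) by (intro open_Int open_UN) auto
    fix i assume i: "i \<in> D"
    show "\<phi> i ` K \<subseteq> K" by (rule K(5)[OF i])
    show "inj_on (\<phi> i) W" using \<phi>'(1)[OF i] WV by (rule inj_on_subset)
    show "\<phi> i ` U \<subseteq> U" using O'(4)[OF i] W_maps[OF i] by (auto simp: U_def)
    show "\<phi> i ` U \<inter> \<phi> j ` U = {}" if "j \<in> D" "i \<noteq> j" for j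
      using O'(5)[OF i that] by (auto simp: U_def)
    fix x assume x: "x \<in> W"
    then have xV: "x \<in> V" using WV by blast
    show "(\<phi> i has_derivative blinfun_apply (\<phi>' i x)) (at x)"
      using \<phi>'(3)[OF i] xV by (simp add: conformal_on_def)
    show "norm (blinfun_apply (\<phi>' i x) h) = norm (\<phi>' i x) * norm h" for h
      using \<phi>'(3)[OF i] xV by (simp add: conformal_on_def)
    show "m \<le> norm (\<phi>' i x)" using mq[OF i] q3(2)[OF i xV] by linarith
    show "norm (\<phi>' i x) \<le> r" using qr(2)[OF i] q2(2)[OF i xV] by linarith
    fix y assume "y \<in> W"
    then have yV: "y \<in> V" using WV by blast
    show "dist (\<phi> i x) (\<phi> i y) \<le> r * dist x y" by (rule contract[OF i xV yV])
    show "\<bar>norm (\<phi>' i x) - norm (\<phi>' i y)\<bar> \<le> c * dist x y powr \<alpha>"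
      using \<alpha>(3)[OF i xV yV] by (simp add: dist_norm)
  qed
  then show ?thesis by (rule that)
qed

lemma hausdorff_measure_empty: "hausdorff_measure t ({} :: 'a::metric_space set) = 0"
proof -
  have "hausdorff_premeasure t \<delta> ({} :: 'a set) = 0" if "0 < \<delta>" for \<delta>
  proof -
    have "hausdorff_premeasure t \<delta> ({} :: 'a set) \<le>
        (\<Sum>k. if (\<lambda>_::nat. {} :: 'a set) k = {} then 0 else ennreal (rpow (diameter ({} :: 'a set)) t))"
      unfolding hausdorff_premeasure_def using that by (intro INF_lower2[of "\<lambda>_. {}"]) auto
    then show ?thesis by simp
  qed
  then show ?thesis by (simp add: hausdorff_measure_def)
qed

theorem theorem1p8:
  fixes K V X :: "'a::euclidean_space set"
    and D :: "'i set"
    and \<phi> :: "'i \<Rightarrow> 'a \<Rightarrow> 'a"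
  assumes "conformal_ifs K V D \<phi>"
    and "open_set_condition V D \<phi>"
    and "attractor K D \<phi> X"
  shows "\<exists>Y\<subseteq>X. hausdorff_dim Y = hausdorff_dim X \<and>
    (\<forall>z\<in>Y. \<forall>\<theta>::nat \<Rightarrow> real.
       (\<forall>n. 0 \<le> \<theta> n) \<longrightarrow>
       (\<Sum>n. \<Sum>I\<in>words D (Suc n).
          ennreal (rpow (diameter (word_map \<phi> I ` X) * \<theta> (Suc n)) (hausdorff_dim X))) = \<infinity> \<longrightarrow>
       hausdorff_measure (hausdorff_dim X) (X - limsup_set D \<phi> X \<theta> z) = 0)"
proof -
  obtain W U \<phi>' \<epsilon> r m c \<alpha> where "conformal_system K W X U D \<phi> \<phi>' \<epsilon> r m c \<alpha>"
    using conformal_system_exists[OF assms] by blast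
  then interpret conformal_system K W X U D \<phi> \<phi>' \<epsilon> r m c \<alpha> .
  have "hausdorff_measure (hausdorff_dim X) (X - limsup_set D \<phi> X \<theta> z) = 0"
    if z: "z \<in> X" and \<theta>: "\<forall>n. 0 \<le> \<theta> n"
      and diverge: "(\<Sum>n. \<Sum>I\<in>words D (Suc n).
          ennreal (rpow (diameter (word_map \<phi> I ` X) * \<theta> (Suc n)) (hausdorff_dim X))) = \<infinity>"
    for z and \<theta> :: "nat \<Rightarrow> real"
  proof (cases "2 \<le> card D")
    case True
    obtain s \<nu> A B \<rho> where *: "0 < s" "1 \<le> A" "gibbs_weight D \<nu> B \<rho>"
      "\<And>I. set I \<subseteq> D \<Longrightarrow> lam I powr s \<le> A * \<nu> I" "\<And>I. set I \<subseteq> D \<Longrightarrow> \<nu> I \<le> A * lam I powr s"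
      by (rule gibbs_weight_for_scales[OF True]) blast
    interpret gibbs_weight D \<nu> B \<rho> by (rule *(3))
    interpret conformal_gibbs K W X U D \<phi> \<phi>' \<epsilon> r m c \<alpha> \<nu> B \<rho> s A
      by unfold_locales (use * in auto)
    show ?thesis
      using limsup_set_full_measure[OF z] \<theta> diverge unfolding hausdorff_dim_attractor by blast
  next
    case False
    then have "card D = 1" using finite_D D_nonempty card_gt_0_iff[of D] by linarith
    then obtain i where "D = {i}" by (rule card_1_singletonE)
    then have "X - limsup_set D \<phi> X \<theta> z = {}" using limsup_set_single_map z by blast
    then show ?thesis by (simp only: hausdorff_measure_empty)
  qed
  then show ?thesis by (intro exI[of _ X]) auto
qed

end
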